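(* Let $G$ be a (small) groupoid and let $A=B\rtimes_\alpha^\sigma G$ be a crossed product algebra where $B$ is a $G$-simple ring. (a) If $B$ is a maximal commutative subring of $A$, then $A$ is simple. (b) If $G$ is locally abelian and connected, and for each $e\in\mathrm{ob}(G)$ the ring $Z(A_{G_e})$ is simple, then $A$ is simple.
   Context: Rings are not necessarily associative. Ideals are two-sided. A ring is simple if it has no ideals other than $\{0\}$ and itself. For a small category $G$ (a groupoid is a category in which all morphisms are isomorphisms), $\mathrm{ob}(G)$ and $\mathrm{mor}(G)$ are its objects and morphisms (objects are identified with their identity morphisms), $d(g)$ and $c(g)$ are the domain and codomain of a morphism $g$, and $G^{(2)}$ is the set of pairs $(g,h)$ of morphisms with $d(g)=c(h)$. $G$ is connected if for all objects $e,f$ there is a morphism from $e$ to $f$. For $e\in\mathrm{ob}(G)$, $G_e$ is the group of morphisms $g$ with $d(g)=c(g)=e$; $G$ is locally abelian if every $G_e$ is abelian. Crossed product: Let $\mathrm{Ring}$ be the category of unital rings and ring homomorphisms preserving the multiplicative identity. A crossed system is a pair $(\sigma,\alpha)$ where $\sigma:G\to\mathrm{Ring}$ is a functor, with $B_e$ denoting the ring assigned to $e\in\mathrm{ob}(G)$ and $\sigma_g:B_{d(g)}\to B_{c(g)}$ the homomorphism assigned to $g\in\mathrm{mor}(G)$, and $\alpha$ assigns to each $(g,h)\in G^{(2)}$ a unit $\alpha_{g,h}$ of $B_{c(g)}$ which associates and commutes with elements of $B_{c(g)}$, i.e. $\alpha_{g,h}(bc)=(b\alpha_{g,h})c=b(\alpha_{g,h}c)=(bc)\alpha_{g,h}$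 for all $b,c\in B_{c(g)}$; moreover $\alpha_{c(g),g}=\alpha_{g,d(g)}=1_{B_{c(g)}}$ for all $g$. Put $B=\bigoplus_{e\in\mathrm{ob}(G)}B_e$. The crossed product algebra $A=B\rtimes_\alpha^\sigma G$ is the set of formal sums $\sum_{g\in\mathrm{mor}(G)}b_gu_g$ with $b_g\in B_{c(g)}$, all but finitely many zero, with pointwise addition and multiplication the biadditive extension of $(a_gu_g)(b_hu_h)=a_g\sigma_g(b_h)\alpha_{g,h}u_{gh}$ if $d(g)=c(h)$ and $(a_gu_g)(b_hu_h)=0$ otherwise. It is graded by $A_g=B_{c(g)}u_g$ and locally unital (each $A_e$, $e\in\mathrm{ob}(G)$, is non-zero and unital with identity $1_{B_e}u_e$); $B$ is identified with $\bigoplus_{e\in\mathrm{ob}(G)}A_e$. $A_{G_e}=\bigoplus_{g\in G_e}A_g$. For an ideal $I$ of $B$ put $I_e=I\cap B_e$. $I$ is $G$-invariant if $\sigma_g(I_{d(g)})\subseteq I_{c(g)}$ for all $g\in\mathrm{mor}(G)$. $B$ is $G$-simple if there is no non-trivial $G$-invariant ideal of $B$ (i.e. none other than $\{0\}$ and $B$). $C_A(B)$ is the set of elements of $A$ commuting with every element of $B$; $B$ is a maximal commutative subring of $A$ if $C_A(B)=B$; the center $Z(R)$ of a ring $R$ is the set of elements of $R$ commuting with every element of $R$. *)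

theory Defs
  imports "HOL-Algebra.AbelCoset" "HOL-Algebra.Ring"
begin

section \<open>Rings that need not be associative\<close>

text \<open>The field \<open>one\<close> of the record is not constrained here; only
  \<open>unital_nonassoc_ring\<close> refers to it. Unital rings are taken to be non-zero.\<close>

locale nonassoc_ring = abelian_group R for R (structure) +
  assumes m_closed: "\<lbrakk>x \<in> carrier R; y \<in> carrier R\<rbrakk> \<Longrightarrow> x \<otimes> y \<in> carrier R"
    and l_distr: "\<lbrakk>x \<in> carrier R; y \<in> carrier R; z \<in> carrier R\<rbrakk>
      \<Longrightarrow> (x \<oplus> y) \<otimes> z = x \<otimes> z \<oplus> y \<otimes> z"
    and r_distr: "\<lbrakk>x \<in> carrier R; y \<in> carrier R; z \<in> carrier R\<rbrakk>
      \<Longrightarrow> z \<otimes> (x \<oplus> y) = z \<otimes> x \<oplus> z \<otimes> y"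

locale unital_nonassoc_ring = nonassoc_ring +
  assumes one_closed: "\<one> \<in> carrier R"
    and l_one: "x \<in> carrier R \<Longrightarrow> \<one> \<otimes> x = x"
    and r_one: "x \<in> carrier R \<Longrightarrow> x \<otimes> \<one> = x"
    and one_not_zero: "\<one> \<noteq> \<zero>"

locale nonassoc_ideal = additive_subgroup I R for I and R (structure) +
  assumes I_l_closed: "\<lbrakk>a \<in> I; x \<in> carrier R\<rbrakk> \<Longrightarrow> x \<otimes> a \<in> I"
    and I_r_closed: "\<lbrakk>a \<in> I; x \<in> carrier R\<rbrakk> \<Longrightarrow> a \<otimes> x \<in> I"

locale simple_nonassoc_ring = nonassoc_ring +
  assumes trivial_ideals: "nonassoc_ideal I R \<Longrightarrow> I = {\<zero>} \<or> I = carrier R"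

definition centralizer :: "('a, 'm) ring_scheme \<Rightarrow> 'a set \<Rightarrow> 'a set" where
  "centralizer R S = {x \<in> carrier R. \<forall>s\<in>S. x \<otimes>\<^bsub>R\<^esub> s = s \<otimes>\<^bsub>R\<^esub> x}"

definition maximal_commutative :: "'a set \<Rightarrow> ('a, 'm) ring_scheme \<Rightarrow> bool" where
  "maximal_commutative S R \<longleftrightarrow> centralizer R S = S"

abbreviation restrict_ring :: "'a ring \<Rightarrow> 'a set \<Rightarrow> 'a ring" where
  "restrict_ring R S \<equiv> R\<lparr>carrier := S\<rparr>"

text \<open>In the absence of associativity the set of elements commuting with everything need not be
  closed under multiplication; \<open>simple_nonassoc_ring (center R)\<close> includes the claim that it is.\<close>

definition center :: "'a ring \<Rightarrow> 'a ring" where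
  "center R = restrict_ring R (centralizer R (carrier R))"

section \<open>Small categories and groupoids\<close>

text \<open>Objects are identified with their identity morphisms, and \<open>cmp G g h\<close> is the composite
  \<open>gh\<close>, relevant only when \<open>dmn G g = cdm G h\<close>.\<close>

record 'g cat =
  mor :: "'g set"
  ob :: "'g set"
  dmn :: "'g \<Rightarrow> 'g"
  cdm :: "'g \<Rightarrow> 'g"
  cmp :: "'g \<Rightarrow> 'g \<Rightarrow> 'g"

locale small_category =
  fixes G :: "'g cat"
  assumes ob_mor: "ob G \<subseteq> mor G"
    and dmn_ob: "g \<in> mor G \<Longrightarrow> dmn G g \<in> ob G"
    and cdm_ob: "g \<in> mor G \<Longrightarrow> cdm G g \<in> ob G"
    and dmn_id: "e \<in> ob G \<Longrightarrow> dmn G e = e"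
    and cdm_id: "e \<in> ob G \<Longrightarrow> cdm G e = e"
    and cmp_mor: "\<lbrakk>g \<in> mor G; h \<in> mor G; dmn G g = cdm G h\<rbrakk> \<Longrightarrow> cmp G g h \<in> mor G"
    and dmn_cmp: "\<lbrakk>g \<in> mor G; h \<in> mor G; dmn G g = cdm G h\<rbrakk> \<Longrightarrow> dmn G (cmp G g h) = dmn G h"
    and cdm_cmp: "\<lbrakk>g \<in> mor G; h \<in> mor G; dmn G g = cdm G h\<rbrakk> \<Longrightarrow> cdm G (cmp G g h) = cdm G g"
    and cmp_assoc: "\<lbrakk>g \<in> mor G; h \<in> mor G; k \<in> mor G; dmn G g = cdm G h; dmn G h = cdm G k\<rbrakk>
      \<Longrightarrow> cmp G (cmp G g h) k = cmp G g (cmp G h k)"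
    and cmp_id_left: "g \<in> mor G \<Longrightarrow> cmp G (cdm G g) g = g"
    and cmp_id_right: "g \<in> mor G \<Longrightarrow> cmp G g (dmn G g) = g"

locale groupoid = small_category +
  assumes all_iso: "g \<in> mor G \<Longrightarrow> \<exists>h \<in> mor G. dmn G h = cdm G g \<and> cdm G h = dmn G g \<and>
    cmp G g h = cdm G g \<and> cmp G h g = dmn G g"

definition connected_cat :: "'g cat \<Rightarrow> bool" where
  "connected_cat G \<longleftrightarrow> (\<forall>e\<in>ob G. \<forall>f\<in>ob G. \<exists>g\<in>mor G. dmn G g = e \<and> cdm G g = f)"

definition vertex_group :: "'g cat \<Rightarrow> 'g \<Rightarrow> 'g monoid" where
  "vertex_group G e =
    \<lparr>carrier = {g \<in> mor G. dmn G g = e \<and> cdm G g = e}, monoid.mult = cmp G, one = e\<rparr>"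

definition locally_abelian :: "'g cat \<Rightarrow> bool" where
  "locally_abelian G \<longleftrightarrow> (\<forall>e\<in>ob G. comm_group (vertex_group G e))"

section \<open>Crossed systems and crossed products\<close>

text \<open>The values of \<open>B\<close> outside \<open>ob G\<close>, of \<open>\<sigma>\<close> outside \<open>mor G\<close> and of \<open>\<alpha>\<close> on
  non-composable pairs are irrelevant. No cocycle identity is imposed on \<open>\<alpha>\<close>.\<close>

locale crossed_system = small_category G for G :: "'g cat" +
  fixes B :: "'g \<Rightarrow> 'b ring" and \<sigma> :: "'g \<Rightarrow> 'b \<Rightarrow> 'b" and \<alpha> :: "'g \<Rightarrow> 'g \<Rightarrow> 'b"
  assumes B_ring: "e \<in> ob G \<Longrightarrow> unital_nonassoc_ring (B e)"
    and \<sigma>_hom: "g \<in> mor G \<Longrightarrow> \<sigma> g \<in> ring_hom (B (dmn G g)) (B (cdm G g))"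
    and \<sigma>_id: "\<lbrakk>e \<in> ob G; b \<in> carrier (B e)\<rbrakk> \<Longrightarrow> \<sigma> e b = b"
    and \<sigma>_cmp: "\<lbrakk>g \<in> mor G; h \<in> mor G; dmn G g = cdm G h; b \<in> carrier (B (dmn G h))\<rbrakk>
      \<Longrightarrow> \<sigma> (cmp G g h) b = \<sigma> g (\<sigma> h b)"
    and \<alpha>_unit: "\<lbrakk>g \<in> mor G; h \<in> mor G; dmn G g = cdm G h\<rbrakk> \<Longrightarrow> \<alpha> g h \<in> Units (B (cdm G g))"
    and \<alpha>_assoc_comm: "\<lbrakk>g \<in> mor G; h \<in> mor G; dmn G g = cdm G h;
        b \<in> carrier (B (cdm G g)); c \<in> carrier (B (cdm G g))\<rbrakk>
      \<Longrightarrow> \<alpha> g h \<otimes>\<^bsub>B (cdm G g)\<^esub> (b \<otimes>\<^bsub>B (cdm G g)\<^esub> c)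
            = (b \<otimes>\<^bsub>B (cdm G g)\<^esub> \<alpha> g h) \<otimes>\<^bsub>B (cdm G g)\<^esub> c
        \<and> (b \<otimes>\<^bsub>B (cdm G g)\<^esub> \<alpha> g h) \<otimes>\<^bsub>B (cdm G g)\<^esub> c
            = b \<otimes>\<^bsub>B (cdm G g)\<^esub> (\<alpha> g h \<otimes>\<^bsub>B (cdm G g)\<^esub> c)
        \<and> b \<otimes>\<^bsub>B (cdm G g)\<^esub> (\<alpha> g h \<otimes>\<^bsub>B (cdm G g)\<^esub> c)
            = (b \<otimes>\<^bsub>B (cdm G g)\<^esub> c) \<otimes>\<^bsub>B (cdm G g)\<^esub> \<alpha> g h"
    and \<alpha>_id_left: "g \<in> mor G \<Longrightarrow> \<alpha> (cdm G g) g = \<one>\<^bsub>B (cdm G g)\<^esub>"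
    and \<alpha>_id_right: "g \<in> mor G \<Longrightarrow> \<alpha> g (dmn G g) = \<one>\<^bsub>B (cdm G g)\<^esub>"

text \<open>Elements of a direct sum over \<open>S\<close> are functions that are \<open>undefined\<close> outside \<open>S\<close>, so that
  equality of functions is equality of elements. The direct sum has no identity element
  when the index set is infinite, so the field \<open>one\<close> is left unspecified.\<close>

definition direct_sum :: "'i set \<Rightarrow> ('i \<Rightarrow> 'b ring) \<Rightarrow> ('i \<Rightarrow> 'b) ring" where
  "direct_sum S B =
    \<lparr>carrier = {x \<in> (\<Pi>\<^sub>E i\<in>S. carrier (B i)). finite {i \<in> S. x i \<noteq> \<zero>\<^bsub>B i\<^esub>}},
     monoid.mult = (\<lambda>x y. \<lambda>i\<in>S. x i \<otimes>\<^bsub>B i\<^esub> y i),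
     one = undefined,
     zero = (\<lambda>i\<in>S. \<zero>\<^bsub>B i\<^esub>),
     add = (\<lambda>x y. \<lambda>i\<in>S. x i \<oplus>\<^bsub>B i\<^esub> y i)\<rparr>"

definition single :: "'i set \<Rightarrow> ('i \<Rightarrow> 'b ring) \<Rightarrow> 'i \<Rightarrow> 'b \<Rightarrow> 'i \<Rightarrow> 'b" where
  "single S B j b = (\<lambda>i\<in>S. if i = j then b else \<zero>\<^bsub>B i\<^esub>)"

text \<open>The function \<open>x\<close> stands for the formal sum of the \<open>x g u\<^sub>g\<close>. As an additive group the
  crossed product is thus the direct sum of the \<open>B (cdm G g)\<close> over all morphisms \<open>g\<close>.\<close>

definition supp :: "'g cat \<Rightarrow> ('g \<Rightarrow> 'b ring) \<Rightarrow> ('g \<Rightarrow> 'b) \<Rightarrow> 'g set" where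
  "supp G B x = {g \<in> mor G. x g \<noteq> \<zero>\<^bsub>B (cdm G g)\<^esub>}"

definition crossed_mult ::
  "'g cat \<Rightarrow> ('g \<Rightarrow> 'b ring) \<Rightarrow> ('g \<Rightarrow> 'b \<Rightarrow> 'b) \<Rightarrow> ('g \<Rightarrow> 'g \<Rightarrow> 'b)
    \<Rightarrow> ('g \<Rightarrow> 'b) \<Rightarrow> ('g \<Rightarrow> 'b) \<Rightarrow> ('g \<Rightarrow> 'b)" where
  "crossed_mult G B \<sigma> \<alpha> x y = (\<lambda>k\<in>mor G.
     finsum (B (cdm G k))
       (\<lambda>(g, h). x g \<otimes>\<^bsub>B (cdm G g)\<^esub> \<sigma> g (y h) \<otimes>\<^bsub>B (cdm G g)\<^esub> \<alpha> g h)
       {(g, h) \<in> supp G B x \<times> supp G B y. dmn G g = cdm G h \<and> cmp G g h = k})"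

definition crossed_product ::
  "'g cat \<Rightarrow> ('g \<Rightarrow> 'b ring) \<Rightarrow> ('g \<Rightarrow> 'b \<Rightarrow> 'b) \<Rightarrow> ('g \<Rightarrow> 'g \<Rightarrow> 'b) \<Rightarrow> ('g \<Rightarrow> 'b) ring" where
  "crossed_product G B \<sigma> \<alpha> =
    direct_sum (mor G) (\<lambda>g. B (cdm G g)) \<lparr>monoid.mult := crossed_mult G B \<sigma> \<alpha>\<rparr>"

text \<open>The biadditive extension does what it should on homogeneous elements: the first lemma is the
  rule \<open>(a u\<^sub>g) (b u\<^sub>h) = a \<sigma>\<^sub>g(b) \<alpha>\<^sub>g\<^sub>,\<^sub>h u\<^sub>g\<^sub>h\<close>, the second the rule for pairs that
  cannot be composed.\<close>

abbreviation hom_elem :: "'g cat \<Rightarrow> ('g \<Rightarrow> 'b ring) \<Rightarrow> 'b \<Rightarrow> 'g \<Rightarrow> 'g \<Rightarrow> 'b" where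
  "hom_elem G B b g \<equiv> single (mor G) (\<lambda>k. B (cdm G k)) g b"

context crossed_system
begin

lemma hom_elem_mult:
  assumes g: "g \<in> mor G" and h: "h \<in> mor G" and gh: "dmn G g = cdm G h"
    and a: "a \<in> carrier (B (cdm G g))" and b: "b \<in> carrier (B (cdm G h))"
  shows "crossed_mult G B \<sigma> \<alpha> (hom_elem G B a g) (hom_elem G B b h) =
    hom_elem G B (a \<otimes>\<^bsub>B (cdm G g)\<^esub> \<sigma> g b \<otimes>\<^bsub>B (cdm G g)\<^esub> \<alpha> g h) (cmp G g h)"
proof -
  let ?R = "B (cdm G g)" and ?S = "B (cdm G h)"
  let ?x = "hom_elem G B a g" and ?y = "hom_elem G B b h"
  let ?f = "\<lambda>(g, h). ?x g \<otimes>\<^bsub>B (cdm G g)\<^esub> \<sigma> g (?y h) \<otimes>\<^bsub>B (cdm G g)\<^esub> \<alpha> g h"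
  let ?t = "a \<otimes>\<^bsub>?R\<^esub> \<sigma> g b \<otimes>\<^bsub>?R\<^esub> \<alpha> g h"
  interpret R: unital_nonassoc_ring ?R using B_ring cdm_ob g by blast
  interpret S: unital_nonassoc_ring ?S using B_ring cdm_ob h by blast
  have hom: "\<sigma> g \<in> ring_hom ?S ?R" using \<sigma>_hom[OF g] gh by simp
  have \<sigma>b: "\<sigma> g b \<in> carrier ?R" using ring_hom_closed[OF hom b] .
  have al: "\<alpha> g h \<in> carrier ?R" using \<alpha>_unit[OF g h gh] by (simp add: Units_def)
  have Rl: "\<zero>\<^bsub>?R\<^esub> \<otimes>\<^bsub>?R\<^esub> z = \<zero>\<^bsub>?R\<^esub>" if z: "z \<in> carrier ?R" for z
    using R.l_distr[OF R.zero_closed R.zero_closed z] R.m_closed[OF R.zero_closed z]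
    by (metis R.add.r_cancel_one R.l_zero R.zero_closed)
  have Rr: "z \<otimes>\<^bsub>?R\<^esub> \<zero>\<^bsub>?R\<^esub> = \<zero>\<^bsub>?R\<^esub>" if z: "z \<in> carrier ?R" for z
    using R.r_distr[OF R.zero_closed R.zero_closed z] R.m_closed[OF z R.zero_closed]
    by (metis R.add.r_cancel_one R.l_zero R.zero_closed)
  have \<sigma>0: "\<sigma> g \<zero>\<^bsub>?S\<^esub> = \<zero>\<^bsub>?R\<^esub>"
    using ring_hom_add[OF hom S.zero_closed S.zero_closed] ring_hom_closed[OF hom S.zero_closed]
    by (metis R.add.r_cancel_one S.l_zero S.zero_closed)
  have tc: "?t \<in> carrier ?R" by (intro R.m_closed a \<sigma>b al)
  have sx: "supp G B ?x = (if a = \<zero>\<^bsub>?R\<^esub> then {} else {g})"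
    using g by (auto simp: supp_def single_def)
  have sy: "supp G B ?y = (if b = \<zero>\<^bsub>?S\<^esub> then {} else {h})"
    using h by (auto simp: supp_def single_def)
  have fgh: "?f (g, h) = ?t" using g h by (simp add: single_def)
  show ?thesis
  proof (rule ext)
    fix k
    let ?P = "{(g, h) \<in> supp G B ?x \<times> supp G B ?y. dmn G g = cdm G h \<and> cmp G g h = k}"
    show "crossed_mult G B \<sigma> \<alpha> ?x ?y k = hom_elem G B ?t (cmp G g h) k"
    proof (cases "k \<in> mor G")
      case True
      interpret K: unital_nonassoc_ring "B (cdm G k)" using B_ring cdm_ob True by blast
      show ?thesis
      proof (cases "k = cmp G g h \<and> a \<noteq> \<zero>\<^bsub>?R\<^esub> \<and> b \<noteq> \<zero>\<^bsub>?S\<^esub>")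
        case t: True
        have ck: "cdm G k = cdm G g" using t cdm_cmp[OF g h gh] by simp
        have P: "?P = insert (g, h) {}" using t gh sx sy by auto
        have "finsum ?R ?f (insert (g, h) {}) = ?t"
          by (subst R.finsum_insert) (use tc fgh in auto)
        thus ?thesis using True t ck P by (simp add: crossed_mult_def single_def)
      next
        case f: False
        have P: "?P = {}" using f sx sy by auto
        have "?t = \<zero>\<^bsub>?R\<^esub>" if "k = cmp G g h"
          using f that Rl Rr \<sigma>0 \<sigma>b al a by auto
        hence "hom_elem G B ?t (cmp G g h) k = \<zero>\<^bsub>B (cdm G k)\<^esub>"
          using True cdm_cmp[OF g h gh] by (auto simp: single_def)
        moreover have "crossed_mult G B \<sigma> \<alpha> ?x ?y k = \<zero>\<^bsub>B (cdm G k)\<^esub>"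
          using True by (simp only: crossed_mult_def P K.finsum_empty restrict_apply if_True)
        ultimately show ?thesis by simp
      qed
    qed (simp add: crossed_mult_def single_def)
  qed
qed

lemma hom_elem_mult_zero:
  assumes "g \<in> mor G" "h \<in> mor G" "dmn G g \<noteq> cdm G h"
  shows "crossed_mult G B \<sigma> \<alpha> (hom_elem G B a g) (hom_elem G B b h) =
    \<zero>\<^bsub>crossed_product G B \<sigma> \<alpha>\<^esub>"
proof (rule ext)
  fix k
  let ?x = "hom_elem G B a g" and ?y = "hom_elem G B b h"
  have "supp G B ?x \<subseteq> {g}" "supp G B ?y \<subseteq> {h}"
    by (auto simp: supp_def single_def split: if_splits)
  hence P: "{(g, h) \<in> supp G B ?x \<times> supp G B ?y. dmn G g = cdm G h \<and> cmp G g h = k} = {}"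
    using assms by auto
  show "crossed_mult G B \<sigma> \<alpha> ?x ?y k = \<zero>\<^bsub>crossed_product G B \<sigma> \<alpha>\<^esub> k"
  proof (cases "k \<in> mor G")
    case True
    interpret K: unital_nonassoc_ring "B (cdm G k)" using B_ring cdm_ob True by blast
    show ?thesis
      using True by (simp only: crossed_mult_def P K.finsum_empty restrict_apply if_True)
        (simp add: crossed_product_def direct_sum_def)
  qed (simp add: crossed_mult_def crossed_product_def direct_sum_def)
qed

end

text \<open>\<open>homogeneous_part G B \<sigma> \<alpha> H\<close> is the sum of the components \<open>A\<^sub>g\<close> with \<open>g \<in> H\<close>. For \<open>H = ob G\<close>
  it is the copy of the direct sum \<open>B\<close> inside the crossed product.\<close>

definition homogeneous_part ::
  "'g cat \<Rightarrow> ('g \<Rightarrow> 'b ring) \<Rightarrow> ('g \<Rightarrow> 'b \<Rightarrow> 'b) \<Rightarrow> ('g \<Rightarrow> 'g \<Rightarrow> 'b) \<Rightarrow> 'g set \<Rightarrow> ('g \<Rightarrow> 'b) set" where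
  "homogeneous_part G B \<sigma> \<alpha> H = {x \<in> carrier (crossed_product G B \<sigma> \<alpha>). supp G B x \<subseteq> H}"

definition invariant_ideal ::
  "'g cat \<Rightarrow> ('g \<Rightarrow> 'b ring) \<Rightarrow> ('g \<Rightarrow> 'b \<Rightarrow> 'b) \<Rightarrow> ('g \<Rightarrow> 'b) set \<Rightarrow> bool" where
  "invariant_ideal G B \<sigma> I \<longleftrightarrow>
    nonassoc_ideal I (direct_sum (ob G) B) \<and>
    (let I_at = (\<lambda>e. {b \<in> carrier (B e). single (ob G) B e b \<in> I}) in
      \<forall>g\<in>mor G. \<sigma> g ` I_at (dmn G g) \<subseteq> I_at (cdm G g))"

definition G_simple :: "'g cat \<Rightarrow> ('g \<Rightarrow> 'b ring) \<Rightarrow> ('g \<Rightarrow> 'b \<Rightarrow> 'b) \<Rightarrow> bool" where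
  "G_simple G B \<sigma> \<longleftrightarrow> (\<forall>I. invariant_ideal G B \<sigma> I \<longrightarrow>
    I = {\<zero>\<^bsub>direct_sum (ob G) B\<^esub>} \<or> I = carrier (direct_sum (ob G) B))"

end

theory Submission
  imports Defs
begin

text \<open>Let \<open>I\<close> be a non-zero ideal of \<open>A\<close>. If \<open>I\<close> contains a non-zero element of some \<open>A\<^sub>e\<close>
  with \<open>e\<close> an object, then \<open>G\<close>-simplicity, applied to the ideals of those \<open>b \<in> B\<^sub>f\<close> for which
  \<open>b u\<^sub>f \<in> I\<close>, gives \<open>I = A\<close>. To find such an element, take a non-zero \<open>x \<in> I\<close> of minimal
  support \<open>S\<close>. Multiplying by suitable \<open>u\<^sub>g\<close>, we may assume that \<open>e \<in> S \<subseteq> G\<^sub>e\<close>, and any commutator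
  in \<open>I\<close> that has smaller support than \<open>S\<close> vanishes.

  In (a), \<open>B\<close> is commutative, so commutators of \<open>x\<close> with elements of \<open>B\<^sub>e\<close> lose the coefficient at
  \<open>e\<close>; hence \<open>x\<close> commutes with \<open>B\<close> and lies in \<open>A\<^sub>e\<close>. In (b), the coefficients at \<open>e\<close> of the
  elements of \<open>I\<close> supported in \<open>S\<close> form an ideal \<open>J\<close> of \<open>B\<^sub>e\<close> that is stable under the abelian
  group \<open>G\<^sub>e\<close>. The sets of those \<open>b \<in> B\<^sub>f\<close> that every \<open>\<sigma>\<^sub>g\<close> with \<open>g : f \<rightarrow> e\<close> maps into \<open>J\<close> form
  a \<open>G\<close>-invariant family of ideals, so \<open>J = B\<^sub>e\<close>, and some \<open>y \<in> I\<close> supported in \<open>S\<close> has coefficient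
  1 at \<open>e\<close>. The commutator of \<open>y\<close> with \<open>b u\<^sub>g\<close>, \<open>g \<in> G\<^sub>e\<close>, is supported in \<open>g S\<close> and vanishes at
  \<open>g\<close>. Thus \<open>y\<close> is central in the sum of the \<open>A\<^sub>g\<close>, \<open>g \<in> G\<^sub>e\<close>, and simplicity of the centre yields
  \<open>u\<^sub>e \<in> I\<close>.\<close>

section \<open>Rings and direct sums\<close>

lemma (in nonassoc_ring) l_null: "x \<in> carrier R \<Longrightarrow> \<zero> \<otimes> x = \<zero>"
  using l_distr[of \<zero> \<zero> x] m_closed[of \<zero> x] by (metis add.r_cancel_one l_zero zero_closed)

lemma (in nonassoc_ring) r_null: "x \<in> carrier R \<Longrightarrow> x \<otimes> \<zero> = \<zero>"
  using r_distr[of \<zero> \<zero> x] m_closed[of x \<zero>] by (metis add.r_cancel_one l_zero zero_closed)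

lemma additive_subgroupI:
  assumes "abelian_group R" "I \<subseteq> carrier R" "\<zero>\<^bsub>R\<^esub> \<in> I"
    and "\<And>x y. \<lbrakk>x \<in> I; y \<in> I\<rbrakk> \<Longrightarrow> x \<oplus>\<^bsub>R\<^esub> y \<in> I"
    and "\<And>x. x \<in> I \<Longrightarrow> \<ominus>\<^bsub>R\<^esub> x \<in> I"
  shows "additive_subgroup I R"
proof -
  interpret abelian_group R by fact
  show ?thesis
    by (intro additive_subgroup.intro add.subgroupI) (use assms in \<open>auto simp: a_inv_def\<close>)
qed

lemma (in additive_subgroup) uminus_closed: "x \<in> H \<Longrightarrow> \<ominus>\<^bsub>G\<^esub> x \<in> H"
  using subgroup.m_inv_closed[OF a_subgroup] by (simp add: a_inv_def)

lemma ring_hom_zero_group: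
  assumes "h \<in> ring_hom R S" "abelian_group R" "abelian_group S"
  shows "h \<zero>\<^bsub>R\<^esub> = \<zero>\<^bsub>S\<^esub>"
proof -
  interpret R: abelian_group R by fact
  interpret S: abelian_group S by fact
  show ?thesis
    using ring_hom_add[OF assms(1) R.zero_closed R.zero_closed]
      ring_hom_closed[OF assms(1) R.zero_closed]
    by (metis S.add.r_cancel_one R.l_zero R.zero_closed)
qed

lemma ring_hom_uminus_group:
  assumes "h \<in> ring_hom R S" "abelian_group R" "abelian_group S" "x \<in> carrier R"
  shows "h (\<ominus>\<^bsub>R\<^esub> x) = \<ominus>\<^bsub>S\<^esub> h x"
proof -
  interpret R: abelian_group R by fact
  interpret S: abelian_group S by fact
  have "h (\<ominus>\<^bsub>R\<^esub> x) \<oplus>\<^bsub>S\<^esub> h x = \<zero>\<^bsub>S\<^esub>"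
    using ring_hom_add[OF assms(1), of "\<ominus>\<^bsub>R\<^esub> x" x] assms(4) ring_hom_zero_group[OF assms(1-3)]
    by (simp add: R.l_neg)
  thus ?thesis
    using S.minus_equality ring_hom_closed[OF assms(1)] assms(4) R.a_inv_closed by metis
qed

section \<open>Direct sums of abelian groups, needed over \<open>ob G\<close> and over
  \<open>mor G\<close>\<close>

lemma direct_sum_carrier:
  "x \<in> carrier (direct_sum S B) \<longleftrightarrow>
    (\<forall>i\<in>S. x i \<in> carrier (B i)) \<and> (\<forall>i. i \<notin> S \<longrightarrow> x i = undefined) \<and>
    finite {i \<in> S. x i \<noteq> \<zero>\<^bsub>B i\<^esub>}"
  by (auto simp: direct_sum_def PiE_iff extensional_def)

lemma direct_sum_eqI:
  "\<lbrakk>x \<in> carrier (direct_sum S B); y \<in> carrier (direct_sum S B); \<And>i. i \<in> S \<Longrightarrow> x i = y i\<rbrakk>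
    \<Longrightarrow> x = y"
  by (auto simp: direct_sum_carrier fun_eq_iff) metis

lemma direct_sum_add [simp]:
  "(x \<oplus>\<^bsub>direct_sum S B\<^esub> y) i = (if i \<in> S then x i \<oplus>\<^bsub>B i\<^esub> y i else undefined)"
  by (simp add: direct_sum_def)

lemma direct_sum_zero [simp]:
  "\<zero>\<^bsub>direct_sum S B\<^esub> i = (if i \<in> S then \<zero>\<^bsub>B i\<^esub> else undefined)"
  by (simp add: direct_sum_def)

context
  fixes S :: "'i set" and B :: "'i \<Rightarrow> 'b ring"
  assumes group: "\<And>i. i \<in> S \<Longrightarrow> abelian_group (B i)"
begin

lemma direct_sum_zero_closed: "\<zero>\<^bsub>direct_sum S B\<^esub> \<in> carrier (direct_sum S B)"
  using abelian_monoid.zero_closed[OF abelian_group.axioms(1)[OF group]]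
  by (simp add: direct_sum_carrier cong: conj_cong)

lemma direct_sum_add_closed:
  assumes "x \<in> carrier (direct_sum S B)" "y \<in> carrier (direct_sum S B)"
  shows "x \<oplus>\<^bsub>direct_sum S B\<^esub> y \<in> carrier (direct_sum S B)"
proof -
  have "finite ({i \<in> S. x i \<noteq> \<zero>\<^bsub>B i\<^esub>} \<union> {i \<in> S. y i \<noteq> \<zero>\<^bsub>B i\<^esub>})"
    using assms by (simp add: direct_sum_carrier)
  moreover have "{i \<in> S. x i \<oplus>\<^bsub>B i\<^esub> y i \<noteq> \<zero>\<^bsub>B i\<^esub>}
      \<subseteq> {i \<in> S. x i \<noteq> \<zero>\<^bsub>B i\<^esub>} \<union> {i \<in> S. y i \<noteq> \<zero>\<^bsub>B i\<^esub>}"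
    using abelian_group.axioms(1)[OF group]
    by (auto simp: abelian_monoid.l_zero abelian_monoid.zero_closed)
  ultimately have "finite {i \<in> S. x i \<oplus>\<^bsub>B i\<^esub> y i \<noteq> \<zero>\<^bsub>B i\<^esub>}"
    by (rule rev_finite_subset)
  thus ?thesis
    using assms abelian_monoid.a_closed[OF abelian_group.axioms(1)[OF group]]
    by (simp add: direct_sum_carrier cong: conj_cong)
qed

text \<open>Phrased with the pointwise negative because it supplies the witness for inverses when
  the group axioms are checked; only afterwards does \<open>direct_sum_uminus\<close> identify it
  with \<open>\<ominus>\<close>.\<close>

lemma direct_sum_neg_closed:
  assumes "x \<in> carrier (direct_sum S B)"
  shows "(\<lambda>i\<in>S. \<ominus>\<^bsub>B i\<^esub> x i) \<in> carrier (direct_sum S B)"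
proof -
  have "{i \<in> S. \<ominus>\<^bsub>B i\<^esub> x i \<noteq> \<zero>\<^bsub>B i\<^esub>} \<subseteq> {i \<in> S. x i \<noteq> \<zero>\<^bsub>B i\<^esub>}"
    using abelian_group.minus_equality[OF group] abelian_group.axioms(1)[OF group]
    by (auto simp: abelian_monoid.l_zero abelian_monoid.zero_closed)
  hence "finite {i \<in> S. \<ominus>\<^bsub>B i\<^esub> x i \<noteq> \<zero>\<^bsub>B i\<^esub>}"
    by (rule finite_subset) (use assms in \<open>simp add: direct_sum_carrier\<close>)
  thus ?thesis
    using assms abelian_group.a_inv_closed[OF group]
    by (simp add: direct_sum_carrier cong: conj_cong)
qed

lemma direct_sum_abelian_group: "abelian_group (direct_sum S B)"
proof (rule abelian_groupI)
  let ?D = "direct_sum S B"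
  note m = abelian_group.axioms(1)[OF group]
  note closed = direct_sum_add_closed direct_sum_zero_closed
  show "x \<oplus>\<^bsub>?D\<^esub> y \<in> carrier ?D" if "x \<in> carrier ?D" "y \<in> carrier ?D" for x y
    using that by (rule direct_sum_add_closed)
  show "\<zero>\<^bsub>?D\<^esub> \<in> carrier ?D"
    by (rule direct_sum_zero_closed)
  show "(x \<oplus>\<^bsub>?D\<^esub> y) \<oplus>\<^bsub>?D\<^esub> z = x \<oplus>\<^bsub>?D\<^esub> (y \<oplus>\<^bsub>?D\<^esub> z)"
    if "x \<in> carrier ?D" "y \<in> carrier ?D" "z \<in> carrier ?D" for x y z
    by (intro direct_sum_eqI[of _ S B] closed that)
      (use that in \<open>simp_all add: direct_sum_carrier abelian_monoid.a_assoc[OF m]\<close>)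
  show "x \<oplus>\<^bsub>?D\<^esub> y = y \<oplus>\<^bsub>?D\<^esub> x" if "x \<in> carrier ?D" "y \<in> carrier ?D" for x y
    by (intro direct_sum_eqI[of _ S B] closed that)
      (use that in \<open>simp_all add: direct_sum_carrier abelian_monoid.a_comm[OF m]\<close>)
  show "\<zero>\<^bsub>?D\<^esub> \<oplus>\<^bsub>?D\<^esub> x = x" if "x \<in> carrier ?D" for x
    by (intro direct_sum_eqI[of _ S B] closed that)
      (use that in \<open>simp_all add: direct_sum_carrier abelian_monoid.l_zero[OF m]\<close>)
  show "\<exists>y\<in>carrier ?D. y \<oplus>\<^bsub>?D\<^esub> x = \<zero>\<^bsub>?D\<^esub>" if x: "x \<in> carrier ?D" for x
    by (rule bexI[OF _ direct_sum_neg_closed[OF x]])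
      (use x in \<open>auto simp: direct_sum_carrier abelian_group.l_neg[OF group] fun_eq_iff\<close>)
qed

lemma direct_sum_uminus:
  assumes "x \<in> carrier (direct_sum S B)"
  shows "\<ominus>\<^bsub>direct_sum S B\<^esub> x = (\<lambda>i\<in>S. \<ominus>\<^bsub>B i\<^esub> x i)"
  by (rule abelian_group.minus_equality[OF direct_sum_abelian_group _ assms])
    (use assms direct_sum_neg_closed in
      \<open>auto simp: direct_sum_carrier abelian_group.l_neg[OF group] fun_eq_iff\<close>)

lemma single_closed:
  assumes "b \<in> carrier (B i)"
  shows "single S B i b \<in> carrier (direct_sum S B)"
proof -
  have "finite {j \<in> S. single S B i b j \<noteq> \<zero>\<^bsub>B j\<^esub>}"
    by (rule finite_subset[of _ "{i}"]) (auto simp: single_def split: if_splits)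
  thus ?thesis
    using assms abelian_monoid.zero_closed[OF abelian_group.axioms(1)[OF group]]
    by (auto simp: direct_sum_carrier single_def)
qed

end

section \<open>The crossed product as a ring\<close>

context crossed_system
begin

abbreviation crossed ("\<A>") where "\<A> \<equiv> crossed_product G B \<sigma> \<alpha>"
abbreviation cring_at ("\<B>") where "\<B> g \<equiv> B (cdm G g)"
abbreviation homog ("\<u>") where "\<u> b g \<equiv> hom_elem G B b g"

lemma B_at: "g \<in> mor G \<Longrightarrow> unital_nonassoc_ring (\<B> g)"
  using B_ring cdm_ob by blast

lemma B_at_group: "g \<in> mor G \<Longrightarrow> abelian_group (\<B> g)"
  using B_at by (simp add: unital_nonassoc_ring_def nonassoc_ring_def)

lemma B_group: "e \<in> ob G \<Longrightarrow> abelian_group (B e)"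
  using B_ring by (simp add: unital_nonassoc_ring_def nonassoc_ring_def)

lemma \<sigma>_closed: "\<lbrakk>g \<in> mor G; b \<in> carrier (B (dmn G g))\<rbrakk> \<Longrightarrow> \<sigma> g b \<in> carrier (\<B> g)"
  using \<sigma>_hom ring_hom_closed by metis

lemma \<sigma>_zero: "g \<in> mor G \<Longrightarrow> \<sigma> g \<zero>\<^bsub>B (dmn G g)\<^esub> = \<zero>\<^bsub>\<B> g\<^esub>"
  using ring_hom_zero_group \<sigma>_hom B_group dmn_ob cdm_ob by metis

lemma \<alpha>_closed: "\<lbrakk>g \<in> mor G; h \<in> mor G; dmn G g = cdm G h\<rbrakk> \<Longrightarrow> \<alpha> g h \<in> carrier (\<B> g)"
  using \<alpha>_unit by (simp add: Units_def)

text \<open>Without associativity a left inverse \<beta> of \<alpha> does not automatically cancel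
  it. The rule for \<alpha> with second factor 1 says that \<alpha> commutes with b, and with first
  factor \<beta> it permits rebracketing: \<beta>(b\<alpha>) = \<beta>(\<alpha>b) =
  (\<beta>\<alpha>)b = b.\<close>

lemma \<alpha>_cancel:
  assumes g: "g \<in> mor G" "h \<in> mor G" "dmn G g = cdm G h"
  obtains \<beta> where "\<beta> \<in> carrier (\<B> g)"
    "\<And>b. b \<in> carrier (\<B> g) \<Longrightarrow> \<beta> \<otimes>\<^bsub>\<B> g\<^esub> (b \<otimes>\<^bsub>\<B> g\<^esub> \<alpha> g h) = b"
proof -
  interpret R: unital_nonassoc_ring "\<B> g" using B_at g(1) .
  obtain \<beta> where \<beta>: "\<beta> \<in> carrier (\<B> g)" "\<beta> \<otimes>\<^bsub>\<B> g\<^esub> \<alpha> g h = \<one>\<^bsub>\<B> g\<^esub>"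
    using \<alpha>_unit[OF g] by (auto simp: Units_def)
  have "\<beta> \<otimes>\<^bsub>\<B> g\<^esub> (b \<otimes>\<^bsub>\<B> g\<^esub> \<alpha> g h) = b" if b: "b \<in> carrier (\<B> g)" for b
  proof -
    have "\<alpha> g h \<otimes>\<^bsub>\<B> g\<^esub> b = b \<otimes>\<^bsub>\<B> g\<^esub> \<alpha> g h"
      using \<alpha>_assoc_comm[OF g b R.one_closed] b \<alpha>_closed[OF g] by (simp add: R.r_one R.m_closed)
    hence "\<beta> \<otimes>\<^bsub>\<B> g\<^esub> (b \<otimes>\<^bsub>\<B> g\<^esub> \<alpha> g h) = \<beta> \<otimes>\<^bsub>\<B> g\<^esub> (\<alpha> g h \<otimes>\<^bsub>\<B> g\<^esub> b)" by simp
    also have "\<dots> = (\<beta> \<otimes>\<^bsub>\<B> g\<^esub> \<alpha> g h) \<otimes>\<^bsub>\<B> g\<^esub> b"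
      using \<alpha>_assoc_comm[OF g \<beta>(1) b] by simp
    finally show ?thesis using \<beta>(2) b by (simp add: R.l_one)
  qed
  thus ?thesis using that \<beta>(1) by blast
qed

section \<open>Components, supports and homogeneous elements\<close>

lemma A_carrier:
  "x \<in> carrier \<A> \<longleftrightarrow> x \<in> (\<Pi>\<^sub>E g\<in>mor G. carrier (\<B> g)) \<and> finite (supp G B x)"
  by (simp add: crossed_product_def direct_sum_def supp_def)

lemma A_comp: "\<lbrakk>x \<in> carrier \<A>; g \<in> mor G\<rbrakk> \<Longrightarrow> x g \<in> carrier (\<B> g)"
  by (auto simp: A_carrier)

lemma A_finite_supp: "x \<in> carrier \<A> \<Longrightarrow> finite (supp G B x)"
  by (simp add: A_carrier)

lemma supp_mor: "supp G B x \<subseteq> mor G"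
  by (auto simp: supp_def)

lemma A_eqI:
  "\<lbrakk>x \<in> carrier \<A>; y \<in> carrier \<A>; \<And>g. g \<in> mor G \<Longrightarrow> x g = y g\<rbrakk> \<Longrightarrow> x = y"
  by (auto simp: A_carrier intro: PiE_ext)

lemma A_add [simp]: "g \<in> mor G \<Longrightarrow> (x \<oplus>\<^bsub>\<A>\<^esub> y) g = x g \<oplus>\<^bsub>\<B> g\<^esub> y g"
  by (simp add: crossed_product_def direct_sum_def)

lemma A_zero [simp]: "g \<in> mor G \<Longrightarrow> \<zero>\<^bsub>\<A>\<^esub> g = \<zero>\<^bsub>\<B> g\<^esub>"
  by (simp add: crossed_product_def direct_sum_def)

lemma A_abelian_group: "abelian_group \<A>"
proof -
  let ?D = "direct_sum (mor G) \<B>"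
  have D: "abelian_group ?D" by (rule direct_sum_abelian_group) (rule B_at_group)
  interpret D: abelian_group ?D by fact
  show ?thesis
    unfolding crossed_product_def
    by (rule abelian_groupI)
      (auto simp: D.a_assoc intro: D.a_comm bexI[OF _ D.a_inv_closed] D.l_neg)
qed

lemma A_uminus [simp]:
  assumes "x \<in> carrier \<A>" "g \<in> mor G"
  shows "(\<ominus>\<^bsub>\<A>\<^esub> x) g = \<ominus>\<^bsub>\<B> g\<^esub> x g"
proof -
  \<comment> \<open>The negative is determined by carrier, zero and addition, and
    \<open>crossed_product\<close> alters only the multiplication of the direct sum.\<close>
  have "\<ominus>\<^bsub>\<A>\<^esub> x = \<ominus>\<^bsub>direct_sum (mor G) \<B>\<^esub> x"
    by (simp add: crossed_product_def a_inv_def m_inv_def)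
  moreover have "x \<in> carrier (direct_sum (mor G) \<B>)"
    using assms(1) by (simp add: crossed_product_def)
  ultimately show ?thesis
    using direct_sum_uminus[of "mor G" \<B>] B_at_group assms(2) by simp
qed

lemma A_eq_zero_iff: "x \<in> carrier \<A> \<Longrightarrow> x = \<zero>\<^bsub>\<A>\<^esub> \<longleftrightarrow> supp G B x = {}"
  using A_eqI[of x "\<zero>\<^bsub>\<A>\<^esub>"] abelian_monoid.zero_closed[OF abelian_group.axioms(1)[OF A_abelian_group]]
  by (auto simp: supp_def)

lemma homog_comp: "h \<in> mor G \<Longrightarrow> \<u> b g h = (if h = g then b else \<zero>\<^bsub>\<B> h\<^esub>)"
  by (simp add: single_def)

lemma homog_closed: "b \<in> carrier (\<B> g) \<Longrightarrow> \<u> b g \<in> carrier \<A>"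
  using single_closed[of "mor G" \<B> b g] B_at_group by (simp add: crossed_product_def)

lemma supp_homog: "supp G B (\<u> b g) \<subseteq> {g}"
  by (auto simp: supp_def single_def split: if_splits)

lemma homog_zero: "\<u> \<zero>\<^bsub>\<B> g\<^esub> g = \<zero>\<^bsub>\<A>\<^esub>"
  by (auto simp: single_def crossed_product_def direct_sum_def)

text \<open>Supports are finite, so every element is a finite sum of homogeneous ones. This reduces
  additive properties, such as commuting with a fixed element or lying in an ideal, to the elements
  \<open>\<u> b g\<close>.\<close>

lemma homogeneous_part_induct [consumes 1, case_names zero homog add]:
  assumes "x \<in> homogeneous_part G B \<sigma> \<alpha> H"
    and "P \<zero>\<^bsub>\<A>\<^esub>"
    and "\<And>b g. \<lbrakk>g \<in> H; g \<in> mor G; b \<in> carrier (\<B> g)\<rbrakk> \<Longrightarrow> P (\<u> b g)"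
    and "\<And>x y. \<lbrakk>x \<in> carrier \<A>; y \<in> carrier \<A>; P x; P y\<rbrakk> \<Longrightarrow> P (x \<oplus>\<^bsub>\<A>\<^esub> y)"
  shows "P x"
proof -
  interpret abelian_group \<A> by (rule A_abelian_group)
  \<comment> \<open>The induction runs over a finite set containing the support. Splitting off the
    term at \<open>g\<close> then needs no case distinction on whether that coefficient is
    zero.\<close>
  have "P x" if "finite T" "x \<in> carrier \<A>" "supp G B x \<subseteq> T" "T \<subseteq> H" "T \<subseteq> mor G" for T x
    using that
  proof (induction T arbitrary: x)
    case empty
    thus ?case using assms(2) A_eq_zero_iff by auto
  next
    case (insert g T)
    let ?y = "\<lambda>h\<in>mor G. if h = g then \<zero>\<^bsub>\<B> h\<^esub> else x h"
    have g: "g \<in> mor G" "g \<in> H" using insert by auto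
    have s: "supp G B ?y \<subseteq> T" using insert by (auto simp: supp_def)
    have y: "?y \<in> carrier \<A>"
      using insert.prems finite_subset[OF s insert.hyps(1)] abelian_group.axioms(1)[OF B_at_group]
      by (auto simp: A_carrier abelian_monoid.zero_closed)
    have u: "\<u> (x g) g \<in> carrier \<A>" using homog_closed A_comp g insert by blast
    have eq: "x = ?y \<oplus>\<^bsub>\<A>\<^esub> \<u> (x g) g"
    proof (rule A_eqI)
      fix h assume h: "h \<in> mor G"
      note m = abelian_group.axioms(1)[OF B_at_group]
      show "x h = (?y \<oplus>\<^bsub>\<A>\<^esub> \<u> (x g) g) h"
        using h A_comp[OF insert.prems(1) h] by (cases "h = g")
            (auto simp: homog_comp abelian_monoid.l_zero[OF m] abelian_monoid.r_zero[OF m])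
    qed (use insert y u in auto)
    have "P ?y" using insert s y by auto
    moreover have "P (\<u> (x g) g)"
      by (rule assms(3)[OF g(2) g(1) A_comp[OF insert.prems(1) g(1)]])
    ultimately show ?case by (subst eq) (rule assms(4)[OF y u])
  qed
  moreover have "x \<in> carrier \<A>" "supp G B x \<subseteq> H"
    using assms(1) by (simp_all add: homogeneous_part_def)
  ultimately show ?thesis using A_finite_supp supp_mor subset_refl by metis
qed

section \<open>Coefficients of a product as sums over factorisations of a morphism\<close>

definition mult_term where
  "mult_term x y = (\<lambda>(g, h). x g \<otimes>\<^bsub>\<B> g\<^esub> \<sigma> g (y h) \<otimes>\<^bsub>\<B> g\<^esub> \<alpha> g h)"

text \<open>The factorisations of \<open>k\<close> with left factor in \<open>S\<close> and right
  factor in \<open>T\<close>. Keeping \<open>S\<close> and \<open>T\<close> free, instead of fixing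
  them as supports, allows several products to be summed over one index set.\<close>

definition fibre where
  "fibre S T k = {(g, h) \<in> S \<times> T. dmn G g = cdm G h \<and> cmp G g h = k}"

lemma fibreE:
  assumes "p \<in> fibre S T k" "S \<subseteq> mor G" "T \<subseteq> mor G"
  obtains g h where "p = (g, h)" "g \<in> mor G" "h \<in> mor G" "dmn G g = cdm G h"
    "cmp G g h = k" "cdm G k = cdm G g"
proof -
  obtain g h where "p = (g, h)" "g \<in> S" "h \<in> T" "dmn G g = cdm G h" "cmp G g h = k"
    using assms(1) by (auto simp: fibre_def)
  thus ?thesis using that[of g h] assms cdm_cmp[of g h] by auto
qed

lemma mult_term_closed:
  assumes "g \<in> mor G" "h \<in> mor G" "dmn G g = cdm G h" "x g \<in> carrier (\<B> g)" "y h \<in> carrier (\<B> h)"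
  shows "mult_term x y (g, h) \<in> carrier (\<B> g)"
proof -
  interpret R: unital_nonassoc_ring "\<B> g" using B_at assms(1) .
  show ?thesis
    using assms \<sigma>_closed \<alpha>_closed by (simp add: mult_term_def R.m_closed)
qed

lemma mult_term_fibre:
  assumes "x \<in> carrier \<A>" "y \<in> carrier \<A>" "S \<subseteq> mor G" "T \<subseteq> mor G"
  shows "mult_term x y \<in> fibre S T k \<rightarrow> carrier (\<B> k)"
proof
  fix p assume "p \<in> fibre S T k"
  thus "mult_term x y p \<in> carrier (\<B> k)"
  proof (rule fibreE[OF _ assms(3,4)])
    fix g h assume "p = (g, h)" "g \<in> mor G" "h \<in> mor G" "dmn G g = cdm G h" "cdm G k = cdm G g"
    thus ?thesis using mult_term_closed[of g h x y] assms A_comp by simp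
  qed
qed

text \<open>\<open>crossed_mult\<close> sums over the exact supports. Enlarging them adds only pairs
  in which one coefficient is zero, and these contribute nothing because \<open>\<sigma> g\<close>
  preserves zero and zero annihilates.\<close>

lemma A_mult:
  assumes "x \<in> carrier \<A>" "y \<in> carrier \<A>" "k \<in> mor G"
    and S: "finite S" "supp G B x \<subseteq> S" "S \<subseteq> mor G"
    and T: "finite T" "supp G B y \<subseteq> T" "T \<subseteq> mor G"
  shows "(x \<otimes>\<^bsub>\<A>\<^esub> y) k = finsum (\<B> k) (mult_term x y) (fibre S T k)"
proof -
  interpret R: unital_nonassoc_ring "\<B> k" using B_at assms(3) .
  have "(x \<otimes>\<^bsub>\<A>\<^esub> y) k
      = finsum (\<B> k) (mult_term x y) (fibre (supp G B x) (supp G B y) k)"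
    using assms(3) by (simp add: crossed_product_def crossed_mult_def mult_term_def fibre_def)
  also have "\<dots> = finsum (\<B> k) (mult_term x y) (fibre S T k)"
  proof (rule R.add.finprod_mono_neutral_cong_left)
    show "finite (fibre S T k)"
      by (rule finite_subset[of _ "S \<times> T"]) (use S T in \<open>auto simp: fibre_def\<close>)
    show "fibre (supp G B x) (supp G B y) k \<subseteq> fibre S T k"
      using S T by (auto simp: fibre_def)
    show "mult_term x y \<in> fibre S T k \<rightarrow> carrier (\<B> k)"
      using mult_term_fibre assms by blast
    fix p assume p: "p \<in> fibre S T k - fibre (supp G B x) (supp G B y) k"
    then obtain g h where p: "p = (g, h)" "g \<in> S" "h \<in> T" "\<not> (g \<in> supp G B x \<and> h \<in> supp G B y)"
      and c: "dmn G g = cdm G h" "cmp G g h = k"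
      by (auto simp: fibre_def)
    hence gh: "p = (g, h)" "g \<in> mor G" "h \<in> mor G" "dmn G g = cdm G h"
      "cmp G g h = k" "x g = \<zero>\<^bsub>\<B> g\<^esub> \<or> y h = \<zero>\<^bsub>\<B> h\<^esub>"
      using S(3) T(3) by (auto simp: supp_def)
    have "\<B> g = \<B> k" using cdm_cmp gh by metis
    moreover have "\<sigma> g (y h) \<in> carrier (\<B> g)" "\<alpha> g h \<in> carrier (\<B> g)" "x g \<in> carrier (\<B> g)"
      using gh A_comp assms \<sigma>_closed[of g "y h"] \<alpha>_closed by auto
    moreover have "y h = \<zero>\<^bsub>\<B> h\<^esub> \<Longrightarrow> \<sigma> g (y h) = \<zero>\<^bsub>\<B> g\<^esub>" using \<sigma>_zero gh by metis
    ultimately show "mult_term x y p = \<zero>\<^bsub>\<B> k\<^esub>"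
      using gh(1,6) by (auto simp: mult_term_def R.l_null R.r_null R.m_closed)
  qed auto
  finally show ?thesis .
qed

lemma A_mult_closed:
  assumes x: "x \<in> carrier \<A>" and y: "y \<in> carrier \<A>"
  shows "x \<otimes>\<^bsub>\<A>\<^esub> y \<in> carrier \<A>"
proof -
  let ?S = "supp G B x" and ?T = "supp G B y"
  have c: "(x \<otimes>\<^bsub>\<A>\<^esub> y) k = finsum (\<B> k) (mult_term x y) (fibre ?S ?T k)" if "k \<in> mor G" for k
    by (rule A_mult[OF x y that A_finite_supp[OF x] subset_refl supp_mor
          A_finite_supp[OF y] subset_refl supp_mor])
  \<comment> \<open>A morphism that is not a composite of elements of the two supports has an empty
    fibre, so its coefficient is an empty sum.\<close>
  have "supp G B (x \<otimes>\<^bsub>\<A>\<^esub> y) \<subseteq> (\<lambda>(g, h). cmp G g h) ` (?S \<times> ?T)"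
  proof
    fix k assume k: "k \<in> supp G B (x \<otimes>\<^bsub>\<A>\<^esub> y)"
    hence km: "k \<in> mor G" by (simp add: supp_def)
    interpret R: unital_nonassoc_ring "\<B> k" using B_at km .
    have "fibre ?S ?T k \<noteq> {}"
      using k c[OF km] by (auto simp: supp_def)
    thus "k \<in> (\<lambda>(g, h). cmp G g h) ` (?S \<times> ?T)" by (auto simp: fibre_def)
  qed
  hence "finite (supp G B (x \<otimes>\<^bsub>\<A>\<^esub> y))"
    by (rule finite_subset) (use x y A_finite_supp in auto)
  moreover have "x \<otimes>\<^bsub>\<A>\<^esub> y \<in> (\<Pi>\<^sub>E g\<in>mor G. carrier (\<B> g))"
  proof
    fix k assume km: "k \<in> mor G"
    interpret R: unital_nonassoc_ring "\<B> k" using B_at km .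
    show "(x \<otimes>\<^bsub>\<A>\<^esub> y) k \<in> carrier (\<B> k)"
      unfolding c[OF km] by (rule R.finsum_closed) (rule mult_term_fibre[OF x y supp_mor supp_mor])
  next
    fix k assume "k \<notin> mor G"
    thus "(x \<otimes>\<^bsub>\<A>\<^esub> y) k = undefined" by (simp add: crossed_product_def crossed_mult_def)
  qed
  ultimately show ?thesis by (simp add: A_carrier)
qed

lemma mult_term_add_left:
  assumes "g \<in> mor G" "h \<in> mor G" "dmn G g = cdm G h"
    and "x \<in> carrier \<A>" "y \<in> carrier \<A>" "z \<in> carrier \<A>"
  shows "mult_term (x \<oplus>\<^bsub>\<A>\<^esub> y) z (g, h) = mult_term x z (g, h) \<oplus>\<^bsub>\<B> g\<^esub> mult_term y z (g, h)"
proof -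
  interpret R: unital_nonassoc_ring "\<B> g" using B_at assms(1) .
  have "\<sigma> g (z h) \<in> carrier (\<B> g)" using assms A_comp \<sigma>_closed[of g "z h"] by auto
  thus ?thesis
    using assms A_comp \<alpha>_closed by (simp add: mult_term_def R.l_distr R.m_closed)
qed

lemma mult_term_add_right:
  assumes "g \<in> mor G" "h \<in> mor G" "dmn G g = cdm G h"
    and "x \<in> carrier \<A>" "y \<in> carrier \<A>" "z \<in> carrier \<A>"
  shows "mult_term z (x \<oplus>\<^bsub>\<A>\<^esub> y) (g, h) = mult_term z x (g, h) \<oplus>\<^bsub>\<B> g\<^esub> mult_term z y (g, h)"
proof -
  interpret R: unital_nonassoc_ring "\<B> g" using B_at assms(1) .
  have "\<sigma> g (x h) \<in> carrier (\<B> g)" "\<sigma> g (y h) \<in> carrier (\<B> g)"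
    using assms A_comp \<sigma>_closed[of g "x h"] \<sigma>_closed[of g "y h"] by auto
  moreover have "\<sigma> g (x h \<oplus>\<^bsub>\<B> h\<^esub> y h) = \<sigma> g (x h) \<oplus>\<^bsub>\<B> g\<^esub> \<sigma> g (y h)"
    using ring_hom_add[OF \<sigma>_hom[OF assms(1)]] assms A_comp by simp
  ultimately show ?thesis
    using assms A_comp \<alpha>_closed by (simp add: mult_term_def R.l_distr R.r_distr R.m_closed)
qed

lemma A_ring: "nonassoc_ring \<A>"
proof -
  interpret A: abelian_group \<A> by (rule A_abelian_group)
  show ?thesis
  proof (intro nonassoc_ring.intro nonassoc_ring_axioms.intro A_abelian_group A_mult_closed)
    fix x y z assume x: "x \<in> carrier \<A>" and y: "y \<in> carrier \<A>" and z: "z \<in> carrier \<A>"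
    have xy: "x \<oplus>\<^bsub>\<A>\<^esub> y \<in> carrier \<A>" using x y by simp
    \<comment> \<open>One finite set containing all four supports puts every product over the same
      fibre, where distributivity can be checked term by term.\<close>
    obtain S where S: "finite S" "S \<subseteq> mor G" "supp G B x \<subseteq> S" "supp G B y \<subseteq> S"
      "supp G B z \<subseteq> S" "supp G B (x \<oplus>\<^bsub>\<A>\<^esub> y) \<subseteq> S"
      using that[of "supp G B x \<union> supp G B y \<union> supp G B z \<union> supp G B (x \<oplus>\<^bsub>\<A>\<^esub> y)"]
        x y z xy A_finite_supp supp_mor by auto
    note mult = A_mult[OF _ _ _ S(1) _ S(2) S(1) _ S(2)]
    note fib = mult_term_fibre[OF _ _ S(2) S(2)]
    show "(x \<oplus>\<^bsub>\<A>\<^esub> y) \<otimes>\<^bsub>\<A>\<^esub> z = x \<otimes>\<^bsub>\<A>\<^esub> z \<oplus>\<^bsub>\<A>\<^esub> y \<otimes>\<^bsub>\<A>\<^esub> z"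
    proof (rule A_eqI)
      fix k assume k: "k \<in> mor G"
      interpret R: unital_nonassoc_ring "\<B> k" using B_at k .
      have "finsum (\<B> k) (mult_term (x \<oplus>\<^bsub>\<A>\<^esub> y) z) (fibre S S k) =
        finsum (\<B> k) (\<lambda>p. mult_term x z p \<oplus>\<^bsub>\<B> k\<^esub> mult_term y z p) (fibre S S k)"
      proof (rule R.finsum_cong'[OF refl])
        show "(\<lambda>p. mult_term x z p \<oplus>\<^bsub>\<B> k\<^esub> mult_term y z p) \<in> fibre S S k \<rightarrow> carrier (\<B> k)"
          using fib[OF x z] fib[OF y z] by (simp add: Pi_iff)
        fix p assume "p \<in> fibre S S k"
        thus "mult_term (x \<oplus>\<^bsub>\<A>\<^esub> y) z p = mult_term x z p \<oplus>\<^bsub>\<B> k\<^esub> mult_term y z p"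
          by (rule fibreE[OF _ S(2) S(2)]) (use mult_term_add_left x y z in simp)
      qed
      also have "\<dots> = finsum (\<B> k) (mult_term x z) (fibre S S k)
          \<oplus>\<^bsub>\<B> k\<^esub> finsum (\<B> k) (mult_term y z) (fibre S S k)"
        by (rule R.finsum_addf[OF fib[OF x z] fib[OF y z]])
      finally show "((x \<oplus>\<^bsub>\<A>\<^esub> y) \<otimes>\<^bsub>\<A>\<^esub> z) k = (x \<otimes>\<^bsub>\<A>\<^esub> z \<oplus>\<^bsub>\<A>\<^esub> y \<otimes>\<^bsub>\<A>\<^esub> z) k"
        using mult[OF xy z k S(6) S(5)] mult[OF x z k S(3) S(5)] mult[OF y z k S(4) S(5)] k by simp
    qed (use x y z A_mult_closed in auto)
    show "z \<otimes>\<^bsub>\<A>\<^esub> (x \<oplus>\<^bsub>\<A>\<^esub> y) = z \<otimes>\<^bsub>\<A>\<^esub> x \<oplus>\<^bsub>\<A>\<^esub> z \<otimes>\<^bsub>\<A>\<^esub> y"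
    proof (rule A_eqI)
      fix k assume k: "k \<in> mor G"
      interpret R: unital_nonassoc_ring "\<B> k" using B_at k .
      have "finsum (\<B> k) (mult_term z (x \<oplus>\<^bsub>\<A>\<^esub> y)) (fibre S S k) =
        finsum (\<B> k) (\<lambda>p. mult_term z x p \<oplus>\<^bsub>\<B> k\<^esub> mult_term z y p) (fibre S S k)"
      proof (rule R.finsum_cong'[OF refl])
        show "(\<lambda>p. mult_term z x p \<oplus>\<^bsub>\<B> k\<^esub> mult_term z y p) \<in> fibre S S k \<rightarrow> carrier (\<B> k)"
          using fib[OF z x] fib[OF z y] by (simp add: Pi_iff)
        fix p assume "p \<in> fibre S S k"
        thus "mult_term z (x \<oplus>\<^bsub>\<A>\<^esub> y) p = mult_term z x p \<oplus>\<^bsub>\<B> k\<^esub> mult_term z y p"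
          by (rule fibreE[OF _ S(2) S(2)]) (use mult_term_add_right x y z in simp)
      qed
      also have "\<dots> = finsum (\<B> k) (mult_term z x) (fibre S S k)
          \<oplus>\<^bsub>\<B> k\<^esub> finsum (\<B> k) (mult_term z y) (fibre S S k)"
        by (rule R.finsum_addf[OF fib[OF z x] fib[OF z y]])
      finally show "(z \<otimes>\<^bsub>\<A>\<^esub> (x \<oplus>\<^bsub>\<A>\<^esub> y)) k = (z \<otimes>\<^bsub>\<A>\<^esub> x \<oplus>\<^bsub>\<A>\<^esub> z \<otimes>\<^bsub>\<A>\<^esub> y) k"
        using mult[OF z xy k S(5) S(6)] mult[OF z x k S(5) S(3)] mult[OF z y k S(5) S(4)] k by simp
    qed (use x y z A_mult_closed in auto)
  qed
qed

end

section \<open>Cancellation in the groupoid\<close>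

locale groupoid_crossed_system = groupoid G + crossed_system G B \<sigma> \<alpha>
  for G :: "'g cat" and B :: "'g \<Rightarrow> 'b ring" and \<sigma> \<alpha>
begin

lemma inverseE:
  assumes "g \<in> mor G"
  obtains h where "h \<in> mor G" "dmn G h = cdm G g" "cdm G h = dmn G g"
    "cmp G g h = cdm G g" "cmp G h g = dmn G g"
  using all_iso[OF assms] by blast

text \<open>Cancellation on either side makes a fibre with one factor fixed contain at most one
  pair, so that products with a homogeneous element have explicit coefficients.\<close>

lemma cmp_left_cancel:
  assumes "g \<in> mor G" "h \<in> mor G" "h' \<in> mor G" "dmn G g = cdm G h" "dmn G g = cdm G h'"
    and "cmp G g h = cmp G g h'"
  shows "h = h'"
proof -
  obtain k where k: "k \<in> mor G" "dmn G k = cdm G g" "cmp G k g = dmn G g"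
    by (rule inverseE[OF assms(1)])
  have "h = cmp G k (cmp G g h)"
    using cmp_assoc[OF k(1) assms(1,2) k(2) assms(4)] k(3) cmp_id_left[OF assms(2)] assms(4) by simp
  also have "\<dots> = h'"
    using cmp_assoc[OF k(1) assms(1,3) k(2) assms(5)] k(3) cmp_id_left[OF assms(3)] assms(5,6)
    by simp
  finally show ?thesis .
qed

lemma cmp_right_cancel:
  assumes "g \<in> mor G" "h \<in> mor G" "h' \<in> mor G" "dmn G h = cdm G g" "dmn G h' = cdm G g"
    and "cmp G h g = cmp G h' g"
  shows "h = h'"
proof -
  obtain k where k: "k \<in> mor G" "cdm G k = dmn G g" "cmp G g k = cdm G g"
    by (rule inverseE[OF assms(1)])
  have "h = cmp G (cmp G h g) k"
    using cmp_assoc[OF assms(2,1) k(1) assms(4) k(2)[symmetric]] k(3) cmp_id_right[OF assms(2)]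
      assms(4) by simp
  also have "\<dots> = h'"
    using cmp_assoc[OF assms(3,1) k(1) assms(5) k(2)[symmetric]] k(3) cmp_id_right[OF assms(3)]
      assms(5,6) by simp
  finally show ?thesis .
qed

sublocale A: nonassoc_ring \<A>
  by (rule A_ring)

section \<open>Products with homogeneous elements: coefficients and supports\<close>

lemma homog_mult:
  assumes "g \<in> mor G" "h \<in> mor G" "dmn G g = cdm G h" "a \<in> carrier (\<B> g)" "b \<in> carrier (\<B> h)"
  shows "\<u> a g \<otimes>\<^bsub>\<A>\<^esub> \<u> b h = \<u> (a \<otimes>\<^bsub>\<B> g\<^esub> \<sigma> g b \<otimes>\<^bsub>\<B> g\<^esub> \<alpha> g h) (cmp G g h)"
  using hom_elem_mult[OF assms] by (simp add: crossed_product_def)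

text \<open>At an object the twist \<open>\<sigma> e\<close> is the identity and
  \<open>\<alpha> e e\<close> is 1, so the component of the crossed product at \<open>e\<close> is a
  copy of \<open>B e\<close>.\<close>

lemma homog_mult_ob:
  assumes e: "e \<in> ob G" and a: "a \<in> carrier (B e)" and b: "b \<in> carrier (B e)"
  shows "\<u> a e \<otimes>\<^bsub>\<A>\<^esub> \<u> b e = \<u> (a \<otimes>\<^bsub>B e\<^esub> b) e"
proof -
  interpret R: unital_nonassoc_ring "B e" using B_ring e .
  have "e \<in> mor G" using e ob_mor by blast
  thus ?thesis
    using homog_mult[of e e a b] a b e \<alpha>_id_left[of e] cmp_id_left[of e] \<sigma>_id[OF e b]
    by (simp add: dmn_id cdm_id R.r_one R.m_closed)
qed

lemma homog_add:
  assumes "g \<in> mor G" "a \<in> carrier (\<B> g)" "b \<in> carrier (\<B> g)"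
  shows "\<u> (a \<oplus>\<^bsub>\<B> g\<^esub> b) g = \<u> a g \<oplus>\<^bsub>\<A>\<^esub> \<u> b g"
proof (rule A_eqI)
  interpret R: unital_nonassoc_ring "\<B> g" using B_at assms(1) .
  show "\<u> (a \<oplus>\<^bsub>\<B> g\<^esub> b) g \<in> carrier \<A>" "\<u> a g \<oplus>\<^bsub>\<A>\<^esub> \<u> b g \<in> carrier \<A>"
    using assms by (auto intro!: homog_closed A.a_closed)
  fix h assume h: "h \<in> mor G"
  interpret H: unital_nonassoc_ring "\<B> h" using B_at h .
  show "\<u> (a \<oplus>\<^bsub>\<B> g\<^esub> b) g h = (\<u> a g \<oplus>\<^bsub>\<A>\<^esub> \<u> b g) h"
    using h by (auto simp: homog_comp)
qed

lemma homog_uminus: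
  assumes "g \<in> mor G" "a \<in> carrier (\<B> g)"
  shows "\<u> (\<ominus>\<^bsub>\<B> g\<^esub> a) g = \<ominus>\<^bsub>\<A>\<^esub> \<u> a g"
proof -
  interpret R: unital_nonassoc_ring "\<B> g" using B_at assms(1) .
  have "\<u> (\<ominus>\<^bsub>\<B> g\<^esub> a) g \<oplus>\<^bsub>\<A>\<^esub> \<u> a g = \<zero>\<^bsub>\<A>\<^esub>"
    using homog_add[of g "\<ominus>\<^bsub>\<B> g\<^esub> a" a] assms homog_zero by (simp add: R.l_neg)
  thus ?thesis
    using A.minus_equality assms homog_closed R.a_inv_closed by metis
qed

lemma homog_mult_comp:
  assumes g: "g \<in> mor G" and h: "h \<in> mor G" and gh: "dmn G g = cdm G h"
    and b: "b \<in> carrier (\<B> g)" and x: "x \<in> carrier \<A>"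
  shows "(\<u> b g \<otimes>\<^bsub>\<A>\<^esub> x) (cmp G g h) = b \<otimes>\<^bsub>\<B> g\<^esub> \<sigma> g (x h) \<otimes>\<^bsub>\<B> g\<^esub> \<alpha> g h"
proof -
  interpret R: unital_nonassoc_ring "\<B> g" using B_at g .
  \<comment> \<open>The morphism \<open>h\<close> need not lie in the support of \<open>x\<close>.
    After inserting it the fibre is exactly \<open>{(g, h)}\<close> in every case.\<close>
  have T: "finite (insert h (supp G B x))" "supp G B x \<subseteq> insert h (supp G B x)"
    "insert h (supp G B x) \<subseteq> mor G"
    using A_finite_supp[OF x] h supp_mor by auto
  have f: "fibre {g} (insert h (supp G B x)) (cmp G g h) = {(g, h)}"
    using cmp_left_cancel[OF g _ h _ gh] gh T(3) by (auto simp: fibre_def)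
  have "(\<u> b g \<otimes>\<^bsub>\<A>\<^esub> x) (cmp G g h)
      = finsum (\<B> (cmp G g h)) (mult_term (\<u> b g) x) (fibre {g} (insert h (supp G B x)) (cmp G g h))"
    by (rule A_mult[OF homog_closed[OF b] x cmp_mor[OF g h gh] _ supp_homog _ T]) (use g in auto)
  also have "\<dots> = mult_term (\<u> b g) x (g, h)"
    using mult_term_closed[OF g h gh, of "\<u> b g" x] b g A_comp[OF x h] 
    unfolding f cdm_cmp[OF g h gh] by (subst R.finsum_insert) (auto simp: homog_comp)
  finally show ?thesis using g by (simp add: mult_term_def homog_comp)
qed

lemma mult_homog_comp:
  assumes g: "g \<in> mor G" and h: "h \<in> mor G" and hg: "dmn G h = cdm G g"
    and b: "b \<in> carrier (\<B> g)" and x: "x \<in> carrier \<A>"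
  shows "(x \<otimes>\<^bsub>\<A>\<^esub> \<u> b g) (cmp G h g) = x h \<otimes>\<^bsub>\<B> h\<^esub> \<sigma> h b \<otimes>\<^bsub>\<B> h\<^esub> \<alpha> h g"
proof -
  interpret R: unital_nonassoc_ring "\<B> h" using B_at h .
  have T: "finite (insert h (supp G B x))" "supp G B x \<subseteq> insert h (supp G B x)"
    "insert h (supp G B x) \<subseteq> mor G"
    using A_finite_supp[OF x] h supp_mor by auto
  have f: "fibre (insert h (supp G B x)) {g} (cmp G h g) = {(h, g)}"
    using cmp_right_cancel[OF g _ h _ hg] hg T(3) by (auto simp: fibre_def)
  have "(x \<otimes>\<^bsub>\<A>\<^esub> \<u> b g) (cmp G h g)
      = finsum (\<B> (cmp G h g)) (mult_term x (\<u> b g)) (fibre (insert h (supp G B x)) {g} (cmp G h g))"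
    by (rule A_mult[OF x homog_closed[OF b] cmp_mor[OF h g hg] T _ supp_homog]) (use g in auto)
  also have "\<dots> = mult_term x (\<u> b g) (h, g)"
    using mult_term_closed[OF h g hg, of x "\<u> b g"] b g A_comp[OF x h] 
    unfolding f cdm_cmp[OF h g hg] by (subst R.finsum_insert) (auto simp: homog_comp)
  finally show ?thesis using g by (simp add: mult_term_def homog_comp)
qed

text \<open>Left multiplication by a homogeneous element translates the support and drops the
  morphisms that cannot be composed. As an image, the new support has at most as many elements as
  the old one, which is what minimality arguments need.\<close>

lemma supp_homog_mult:
  assumes g: "g \<in> mor G" and b: "b \<in> carrier (\<B> g)" and x: "x \<in> carrier \<A>"
  shows "supp G B (\<u> b g \<otimes>\<^bsub>\<A>\<^esub> x) \<subseteq> cmp G g ` {h \<in> supp G B x. cdm G h = dmn G g}"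
proof
  fix k assume k: "k \<in> supp G B (\<u> b g \<otimes>\<^bsub>\<A>\<^esub> x)"
  hence km: "k \<in> mor G" by (simp add: supp_def)
  interpret R: unital_nonassoc_ring "\<B> k" using B_at km .
  have "(\<u> b g \<otimes>\<^bsub>\<A>\<^esub> x) k = finsum (\<B> k) (mult_term (\<u> b g) x) (fibre {g} (supp G B x) k)"
    by (rule A_mult[OF homog_closed[OF b] x km _ supp_homog _ A_finite_supp[OF x] subset_refl supp_mor])
      (use g in auto)
  hence "fibre {g} (supp G B x) k \<noteq> {}" using k by (auto simp: supp_def)
  thus "k \<in> cmp G g ` {h \<in> supp G B x. cdm G h = dmn G g}" by (auto simp: fibre_def)
qed

lemma supp_mult_homog:
  assumes g: "g \<in> mor G" and b: "b \<in> carrier (\<B> g)" and x: "x \<in> carrier \<A>"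
  shows "supp G B (x \<otimes>\<^bsub>\<A>\<^esub> \<u> b g) \<subseteq> (\<lambda>h. cmp G h g) ` {h \<in> supp G B x. dmn G h = cdm G g}"
proof
  fix k assume k: "k \<in> supp G B (x \<otimes>\<^bsub>\<A>\<^esub> \<u> b g)"
  hence km: "k \<in> mor G" by (simp add: supp_def)
  interpret R: unital_nonassoc_ring "\<B> k" using B_at km .
  have "(x \<otimes>\<^bsub>\<A>\<^esub> \<u> b g) k = finsum (\<B> k) (mult_term x (\<u> b g)) (fibre (supp G B x) {g} k)"
    by (rule A_mult[OF x homog_closed[OF b] km A_finite_supp[OF x] subset_refl supp_mor _ supp_homog])
      (use g in auto)
  hence "fibre (supp G B x) {g} k \<noteq> {}" using k by (auto simp: supp_def)
  thus "k \<in> (\<lambda>h. cmp G h g) ` {h \<in> supp G B x. dmn G h = cdm G g}" by (force simp: fibre_def)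
qed

text \<open>Translation by an identity moves nothing. A factor at the object \<open>e\<close>
  therefore only cuts the support down, to codomain \<open>e\<close> from the left and to domain
  \<open>e\<close> from the right.\<close>

lemma supp_homog_ob_mult:
  assumes e: "e \<in> ob G" and b: "b \<in> carrier (B e)" and x: "x \<in> carrier \<A>"
  shows "supp G B (\<u> b e \<otimes>\<^bsub>\<A>\<^esub> x) \<subseteq> {h \<in> supp G B x. cdm G h = e}"
proof
  fix k assume k: "k \<in> supp G B (\<u> b e \<otimes>\<^bsub>\<A>\<^esub> x)"
  have "e \<in> mor G" "b \<in> carrier (\<B> e)" using e b ob_mor cdm_id by auto
  then obtain h where "h \<in> supp G B x" "cdm G h = e" "k = cmp G e h"
    using supp_homog_mult[of e b x] x k dmn_id[OF e] by auto
  thus "k \<in> {h \<in> supp G B x. cdm G h = e}"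
    using cmp_id_left[of h] supp_mor by fastforce
qed

lemma supp_mult_homog_ob:
  assumes e: "e \<in> ob G" and b: "b \<in> carrier (B e)" and x: "x \<in> carrier \<A>"
  shows "supp G B (x \<otimes>\<^bsub>\<A>\<^esub> \<u> b e) \<subseteq> {h \<in> supp G B x. dmn G h = e}"
proof
  fix k assume k: "k \<in> supp G B (x \<otimes>\<^bsub>\<A>\<^esub> \<u> b e)"
  have "e \<in> mor G" "b \<in> carrier (\<B> e)" using e b ob_mor cdm_id by auto
  then obtain h where "h \<in> supp G B x" "dmn G h = e" "k = cmp G h e"
    using supp_mult_homog[of e b x] x k cdm_id[OF e] by auto
  thus "k \<in> {h \<in> supp G B x. dmn G h = e}"
    using cmp_id_right[of h] supp_mor by fastforce
qed

lemma homog_ob_mult_comp: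
  assumes e: "e \<in> ob G" and b: "b \<in> carrier (B e)" and x: "x \<in> carrier \<A>"
    and h: "h \<in> mor G" "cdm G h = e"
  shows "(\<u> b e \<otimes>\<^bsub>\<A>\<^esub> x) h = b \<otimes>\<^bsub>B e\<^esub> x h"
proof -
  interpret R: unital_nonassoc_ring "B e" using B_ring e .
  have "e \<in> mor G" "b \<in> carrier (\<B> e)" "x h \<in> carrier (B e)"
    using e b ob_mor cdm_id A_comp[OF x h(1)] h(2) by auto
  thus ?thesis
    using homog_mult_comp[of e h b x] h x e dmn_id cdm_id cmp_id_left[of h] \<alpha>_id_left[of h] \<sigma>_id b
    by (simp add: R.r_one R.m_closed)
qed

text \<open>Unlike in \<open>homog_ob_mult_comp\<close>, the coefficient \<open>b\<close> has to
  pass the basis element at \<open>h\<close> and is twisted by \<open>\<sigma> h\<close>. The two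
  formulas become untwisted together at \<open>h = e\<close>.\<close>

lemma mult_homog_ob_comp:
  assumes e: "e \<in> ob G" and b: "b \<in> carrier (B e)" and x: "x \<in> carrier \<A>"
    and h: "h \<in> mor G" "dmn G h = e"
  shows "(x \<otimes>\<^bsub>\<A>\<^esub> \<u> b e) h = x h \<otimes>\<^bsub>\<B> h\<^esub> \<sigma> h b"
proof -
  interpret R: unital_nonassoc_ring "\<B> h" using B_at h(1) .
  have "e \<in> mor G" "b \<in> carrier (\<B> e)"
    using e b ob_mor cdm_id by auto
  thus ?thesis
    using mult_homog_comp[of e h b x] h x e cdm_id cmp_id_right[of h] \<alpha>_id_right[of h]
      \<sigma>_closed[of h b] b A_comp[OF x h(1)]
    by (simp add: R.r_one R.m_closed)
qed

section \<open>Ideals of the crossed product\<close>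

text \<open>The elements of the direct sum whose components lie in the \<open>K f\<close> form a \<open>G\<close>-invariant ideal.\<close>

lemma G_simple_ideal_family:
  assumes simple: "G_simple G B \<sigma>"
    and ideal: "\<And>f. f \<in> ob G \<Longrightarrow> nonassoc_ideal (K f) (B f)"
    and inv: "\<And>g b. \<lbrakk>g \<in> mor G; b \<in> K (dmn G g)\<rbrakk> \<Longrightarrow> \<sigma> g b \<in> K (cdm G g)"
    and e: "e \<in> ob G" "b \<in> K e" "b \<noteq> \<zero>\<^bsub>B e\<^esub>" and f: "f \<in> ob G"
  shows "K f = carrier (B f)"
proof -
  let ?D = "direct_sum (ob G) B"
  define J where "J = {x \<in> carrier ?D. \<forall>f\<in>ob G. x f \<in> K f}"
  note sub = nonassoc_ideal.axioms(1)[OF ideal]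
  note K0 = additive_subgroup.zero_closed[OF sub] and Ksub = additive_subgroup.a_subset[OF sub]
  have D: "abelian_group ?D" by (rule direct_sum_abelian_group[OF B_group])
  interpret D: abelian_group ?D by fact
  note car = direct_sum_carrier[of _ "ob G" B]
  have ring: "nonassoc_ring (B f)" if "f \<in> ob G" for f
    using B_ring[OF that] by (simp add: unital_nonassoc_ring_def)
  have mult: "x \<otimes>\<^bsub>?D\<^esub> y \<in> carrier ?D" if x: "x \<in> carrier ?D" and y: "y \<in> carrier ?D" for x y
  proof -
    have "{f \<in> ob G. x f \<otimes>\<^bsub>B f\<^esub> y f \<noteq> \<zero>\<^bsub>B f\<^esub>} \<subseteq> {f \<in> ob G. x f \<noteq> \<zero>\<^bsub>B f\<^esub>}"
      using y nonassoc_ring.l_null[OF ring] by (auto simp: car)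
    hence "finite {f \<in> ob G. x f \<otimes>\<^bsub>B f\<^esub> y f \<noteq> \<zero>\<^bsub>B f\<^esub>}"
      by (rule finite_subset) (use x in \<open>simp add: car\<close>)
    moreover have "(x \<otimes>\<^bsub>?D\<^esub> y) f = (if f \<in> ob G then x f \<otimes>\<^bsub>B f\<^esub> y f else undefined)" for f
      by (simp add: direct_sum_def)
    ultimately show ?thesis
      using x y nonassoc_ring.m_closed[OF ring] by (simp add: car cong: conj_cong)
  qed
  have "additive_subgroup J ?D"
  proof (rule additive_subgroupI[OF D])
    show "\<zero>\<^bsub>?D\<^esub> \<in> J" using K0 by (simp add: J_def)
    show "x \<oplus>\<^bsub>?D\<^esub> y \<in> J" if "x \<in> J" "y \<in> J" for x y
      using that additive_subgroup.a_closed[OF sub] by (simp add: J_def)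
    show "\<ominus>\<^bsub>?D\<^esub> x \<in> J" if "x \<in> J" for x
    proof -
      have "\<ominus>\<^bsub>B f\<^esub> x f \<in> K f" if "f \<in> ob G" for f
        using additive_subgroup.uminus_closed[OF sub[OF that]] \<open>x \<in> J\<close> that
        by (simp add: J_def)
      moreover have x: "x \<in> carrier ?D" using that by (simp add: J_def)
      ultimately show ?thesis
        using D.a_inv_closed[OF x] direct_sum_uminus[of "ob G" B x] B_group by (simp add: J_def)
    qed
  qed (auto simp: J_def)
  moreover have "x \<otimes>\<^bsub>?D\<^esub> a \<in> J \<and> a \<otimes>\<^bsub>?D\<^esub> x \<in> J" if "a \<in> J" "x \<in> carrier ?D" for a x
    using that mult nonassoc_ideal.I_l_closed[OF ideal] nonassoc_ideal.I_r_closed[OF ideal]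
    by (simp add: J_def car) (simp add: direct_sum_def)
  ultimately have "nonassoc_ideal J ?D"
    by (intro nonassoc_ideal.intro nonassoc_ideal_axioms.intro) auto
  \<comment> \<open>The component of \<open>J\<close> at \<open>f\<close> is exactly
    \<open>K f\<close>. This turns \<open>inv\<close> into invariance of \<open>J\<close>, and later
    recovers \<open>K f\<close> from \<open>J\<close> being everything.\<close>
  moreover have single: "single (ob G) B f c \<in> J \<longleftrightarrow> c \<in> K f" if "f \<in> ob G" "c \<in> carrier (B f)" for f c
    using single_closed[of "ob G" B c f] that K0 B_group by (auto simp: J_def single_def)
  ultimately have "invariant_ideal G B \<sigma> J"
    using inv \<sigma>_closed dmn_ob cdm_ob by (auto simp: invariant_ideal_def Let_def)
  moreover have "J \<noteq> {\<zero>\<^bsub>?D\<^esub>}"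
  proof
    assume "J = {\<zero>\<^bsub>?D\<^esub>}"
    hence "single (ob G) B e b = \<zero>\<^bsub>?D\<^esub>" using single[OF e(1)] e Ksub by blast
    hence "single (ob G) B e b e = \<zero>\<^bsub>?D\<^esub> e" by simp
    thus False using e by (simp add: single_def)
  qed
  ultimately have "J = carrier ?D" using simple by (auto simp: G_simple_def)
  hence "carrier (B f) \<subseteq> K f"
    using single[OF f] single_closed[of "ob G" B _ f] B_group by blast
  thus ?thesis using Ksub[OF f] by blast
qed

text \<open>Once every \<open>K f\<close> is full, \<open>I\<close> contains the local identity at
  each object. A homogeneous element equals its product with the local identity at its domain, so
  all homogeneous elements, and hence their sums, lie in \<open>I\<close>.\<close>

lemma ideal_eq_carrier:
  assumes I: "nonassoc_ideal I \<A>" and simple: "G_simple G B \<sigma>"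
    and e: "e \<in> ob G" "b \<in> carrier (B e)" "b \<noteq> \<zero>\<^bsub>B e\<^esub>" "\<u> b e \<in> I"
  shows "I = carrier \<A>"
proof -
  interpret I: nonassoc_ideal I \<A> by fact
  define K where "K f = {b \<in> carrier (B f). \<u> b f \<in> I}" for f
  have K: "nonassoc_ideal (K f) (B f)" if f: "f \<in> ob G" for f
  proof -
    interpret R: unital_nonassoc_ring "B f" using B_ring f .
    have fm: "f \<in> mor G" and c: "cdm G f = f" using f ob_mor cdm_id by auto
    show ?thesis
    proof (intro nonassoc_ideal.intro nonassoc_ideal_axioms.intro additive_subgroupI[OF B_group[OF f]])
      show "K f \<subseteq> carrier (B f)" by (auto simp: K_def)
      show "\<zero>\<^bsub>B f\<^esub> \<in> K f" using homog_zero[of f] c I.zero_closed by (simp add: K_def)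
      show "x \<oplus>\<^bsub>B f\<^esub> y \<in> K f" if "x \<in> K f" "y \<in> K f" for x y
        using that homog_add[OF fm, of x y] c I.a_closed by (simp add: K_def)
      show "\<ominus>\<^bsub>B f\<^esub> x \<in> K f" if "x \<in> K f" for x
        using that homog_uminus[OF fm, of x] c I.uminus_closed[of "\<u> x f"]
        by (simp add: K_def R.a_inv_closed)
      fix a x assume a: "a \<in> K f" and x: "x \<in> carrier (B f)"
      have u: "\<u> x f \<in> carrier \<A>" using homog_closed[of x f] c x by simp
      show "x \<otimes>\<^bsub>B f\<^esub> a \<in> K f"
        using homog_mult_ob[OF f x, of a] a x I.I_l_closed[OF _ u, of "\<u> a f"]
        by (simp add: K_def R.m_closed)
      show "a \<otimes>\<^bsub>B f\<^esub> x \<in> K f"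
        using homog_mult_ob[OF f _ x, of a] a x I.I_r_closed[OF _ u, of "\<u> a f"]
        by (simp add: K_def R.m_closed)
    qed
  qed
  \<comment> \<open>With \<open>h\<close> the inverse of \<open>g\<close>: multiplying
    \<open>c\<close> at the object \<open>dmn G g\<close> on the left by 1 at \<open>g\<close> gives
    \<open>\<sigma> g c\<close> at \<open>g\<close>. Then multiplying on the right by 1 at
    \<open>h\<close> moves it to \<open>cdm G g\<close>, at the cost of a factor
    \<open>\<alpha> g h\<close>, which \<beta> removes.\<close>
  have inv: "\<sigma> g c \<in> K (cdm G g)" if g: "g \<in> mor G" and c: "c \<in> K (dmn G g)" for g c
  proof -
    interpret R: unital_nonassoc_ring "\<B> g" using B_at g .
    obtain h where h: "h \<in> mor G" "dmn G h = cdm G g" "cdm G h = dmn G g" "cmp G g h = cdm G g"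
      by (rule inverseE[OF g])
    interpret H: unital_nonassoc_ring "\<B> h" using B_at h(1) .
    obtain \<beta> where \<beta>: "\<beta> \<in> carrier (\<B> g)"
      "\<And>b. b \<in> carrier (\<B> g) \<Longrightarrow> \<beta> \<otimes>\<^bsub>\<B> g\<^esub> (b \<otimes>\<^bsub>\<B> g\<^esub> \<alpha> g h) = b"
      using \<alpha>_cancel[OF g h(1) h(3)[symmetric]] by blast
    have d: "dmn G g \<in> ob G" "dmn G g \<in> mor G" and cg: "cdm G g \<in> ob G"
      using dmn_ob cdm_ob g ob_mor by auto
    have c': "c \<in> carrier (B (dmn G g))" "\<u> c (dmn G g) \<in> I" using c by (auto simp: K_def)
    have \<sigma>c: "\<sigma> g c \<in> carrier (\<B> g)" using \<sigma>_closed g c'(1) .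
    have \<sigma>1: "\<sigma> g \<one>\<^bsub>\<B> h\<^esub> = \<one>\<^bsub>\<B> g\<^esub>" using ring_hom_one[OF \<sigma>_hom[OF g]] h(3) by simp
    have \<alpha>c: "\<alpha> g h \<in> carrier (\<B> g)" using \<alpha>_closed[OF g h(1)] h(3) by simp
    have "\<u> \<one>\<^bsub>\<B> g\<^esub> g \<otimes>\<^bsub>\<A>\<^esub> \<u> c (dmn G g) = \<u> (\<sigma> g c) g"
      using homog_mult[OF g d(2), of "\<one>\<^bsub>\<B> g\<^esub>" c] c' cdm_id[OF d(1)] \<alpha>_id_right[OF g] cmp_id_right[OF g] \<sigma>c
      by (simp add: R.one_closed R.l_one R.r_one)
    hence "\<u> (\<sigma> g c) g \<in> I"
      using I.I_l_closed[OF c'(2) homog_closed[OF R.one_closed]] by simp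
    moreover have "\<u> (\<sigma> g c) g \<otimes>\<^bsub>\<A>\<^esub> \<u> \<one>\<^bsub>\<B> h\<^esub> h = \<u> (\<sigma> g c \<otimes>\<^bsub>\<B> g\<^esub> \<alpha> g h) (cdm G g)"
      using homog_mult[OF g h(1) _ \<sigma>c H.one_closed] h \<sigma>1 \<sigma>c by (simp add: R.r_one)
    ultimately have "\<u> (\<sigma> g c \<otimes>\<^bsub>\<B> g\<^esub> \<alpha> g h) (cdm G g) \<in> I"
      using I.I_r_closed[OF _ homog_closed[OF H.one_closed]] by metis
    moreover have "\<u> \<beta> (cdm G g) \<otimes>\<^bsub>\<A>\<^esub> \<u> (\<sigma> g c \<otimes>\<^bsub>\<B> g\<^esub> \<alpha> g h) (cdm G g) = \<u> (\<sigma> g c) (cdm G g)"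
      using homog_mult_ob[OF cg \<beta>(1) R.m_closed[OF \<sigma>c \<alpha>c]] \<beta>(2)[OF \<sigma>c] by simp
    moreover have "\<u> \<beta> (cdm G g) \<in> carrier \<A>"
      using homog_closed[of \<beta> "cdm G g"] \<beta>(1) cdm_id[OF cg] by simp
    ultimately have "\<u> (\<sigma> g c) (cdm G g) \<in> I" using I.I_l_closed by metis
    thus ?thesis using \<sigma>c by (simp add: K_def)
  qed
  have full: "K f = carrier (B f)" if "f \<in> ob G" for f
    by (rule G_simple_ideal_family[OF simple K inv e(1) _ e(3) that]) (use e in \<open>auto simp: K_def\<close>)
  have "x \<in> I" if "x \<in> carrier \<A>" for x
  proof -
    have "x \<in> homogeneous_part G B \<sigma> \<alpha> (mor G)"
      using that supp_mor by (simp add: homogeneous_part_def)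
    thus ?thesis
    proof (induction rule: homogeneous_part_induct)
      case (homog b g)
      interpret R: unital_nonassoc_ring "\<B> g" using B_at homog(1) .
      have d: "dmn G g \<in> ob G" "dmn G g \<in> mor G" using dmn_ob homog ob_mor by auto
      interpret D: unital_nonassoc_ring "B (dmn G g)" using B_ring d(1) .
      have "\<u> \<one>\<^bsub>B (dmn G g)\<^esub> (dmn G g) \<in> I"
        using full[OF d(1)] D.one_closed by (auto simp: K_def)
      hence "\<u> b g \<otimes>\<^bsub>\<A>\<^esub> \<u> \<one>\<^bsub>B (dmn G g)\<^esub> (dmn G g) \<in> I"
        by (rule I.I_l_closed) (rule homog_closed[OF homog(3)])
      thus ?case
        using homog_mult[OF homog(1) d(2) _ homog(3), of "\<one>\<^bsub>B (dmn G g)\<^esub>"] cdm_id[OF d(1)]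
          \<alpha>_id_right[OF homog(1)] cmp_id_right[OF homog(1)] ring_hom_one[OF \<sigma>_hom[OF homog(1)]] homog(3)
        by (simp add: D.one_closed R.r_one)
    qed (auto intro: I.zero_closed I.a_closed)
  qed
  thus ?thesis using I.a_subset by blast
qed

section \<open>Elements of minimal support\<close>

text \<open>The underlying set of the group \<open>vertex_group G e\<close>.\<close>

definition isotropy where
  "isotropy e = {g \<in> mor G. dmn G g = e \<and> cdm G g = e}"

lemma ob_isotropy: "e \<in> ob G \<Longrightarrow> e \<in> isotropy e"
  using ob_mor dmn_id cdm_id by (auto simp: isotropy_def)

text \<open>Start from any non-zero element of least support and a morphism \<open>g\<close> in that
  support. Right translation by the inverse of \<open>g\<close> moves \<open>g\<close> to the object
  \<open>e = cdm G g\<close> and gives all morphisms domain \<open>e\<close>; left multiplication by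
  the local identity at \<open>e\<close> keeps those with codomain \<open>e\<close>. Neither step
  enlarges the support, so minimality survives.\<close>

lemma minimal_support:
  assumes I: "nonassoc_ideal I \<A>" and x0: "x0 \<in> I" "x0 \<noteq> \<zero>\<^bsub>\<A>\<^esub>"
  obtains e x where "e \<in> ob G" "x \<in> I" "x e \<noteq> \<zero>\<^bsub>B e\<^esub>" "supp G B x \<subseteq> isotropy e"
    "\<forall>z\<in>I. z \<noteq> \<zero>\<^bsub>\<A>\<^esub> \<longrightarrow> card (supp G B x) \<le> card (supp G B z)"
proof -
  interpret I: nonassoc_ideal I \<A> by fact
  have "\<exists>x. (x \<in> I \<and> x \<noteq> \<zero>\<^bsub>\<A>\<^esub>) \<and>
      (\<forall>z. z \<in> I \<and> z \<noteq> \<zero>\<^bsub>\<A>\<^esub> \<longrightarrow> card (supp G B x) \<le> card (supp G B z))"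
    by (rule ex_has_least_nat[of "\<lambda>x. x \<in> I \<and> x \<noteq> \<zero>\<^bsub>\<A>\<^esub>" x0 "\<lambda>x. card (supp G B x)"]) (use x0 in simp)
  then obtain x where x: "x \<in> I" "x \<noteq> \<zero>\<^bsub>\<A>\<^esub>"
    and min: "\<forall>z\<in>I. z \<noteq> \<zero>\<^bsub>\<A>\<^esub> \<longrightarrow> card (supp G B x) \<le> card (supp G B z)"
    by blast
  have xA: "x \<in> carrier \<A>" using x I.a_subset by blast
  obtain g where g: "g \<in> mor G" "x g \<noteq> \<zero>\<^bsub>\<B> g\<^esub>"
    using A_eq_zero_iff[OF xA] x(2) by (auto simp: supp_def)
  interpret R: unital_nonassoc_ring "\<B> g" using B_at g(1) .
  obtain h where h: "h \<in> mor G" "dmn G h = cdm G g" "cdm G h = dmn G g" "cmp G g h = cdm G g"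
    by (rule inverseE[OF g(1)])
  interpret H: unital_nonassoc_ring "\<B> h" using B_at h(1) .
  define e where "e = cdm G g"
  have e: "e \<in> ob G" "e \<in> mor G" using cdm_ob g(1) ob_mor by (auto simp: e_def)
  have one: "\<one>\<^bsub>B e\<^esub> \<in> carrier (B e)" using R.one_closed by (simp add: e_def)
  define y where "y = x \<otimes>\<^bsub>\<A>\<^esub> \<u> \<one>\<^bsub>\<B> h\<^esub> h"
  have yI: "y \<in> I" unfolding y_def by (rule I.I_r_closed[OF x(1) homog_closed[OF H.one_closed]])
  have yA: "y \<in> carrier \<A>" using yI I.a_subset by blast
  have sy: "supp G B y \<subseteq> (\<lambda>k. cmp G k h) ` {k \<in> supp G B x. dmn G k = cdm G h}"
    unfolding y_def by (rule supp_mult_homog[OF h(1) H.one_closed xA])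
  have card_y: "card (supp G B y) \<le> card (supp G B x)"
    using surj_card_le[OF A_finite_supp[OF xA], of "supp G B y" "\<lambda>k. cmp G k h"] sy by blast
  have y_dmn: "dmn G k = e" if "k \<in> supp G B y" for k
    using that sy dmn_cmp[of _ h] h supp_mor by (fastforce simp: e_def)
  have ye: "y e = x g \<otimes>\<^bsub>\<B> g\<^esub> \<alpha> g h"
  proof -
    have "\<sigma> g \<one>\<^bsub>\<B> h\<^esub> = \<one>\<^bsub>\<B> g\<^esub>" using ring_hom_one[OF \<sigma>_hom[OF g(1)]] h(3) by simp
    thus ?thesis
      using mult_homog_comp[OF h(1) g(1) h(3)[symmetric] H.one_closed xA] h A_comp[OF xA g(1)]
      by (simp add: y_def e_def R.r_one)
  qed
  \<comment> \<open>The translated coefficient is \<open>x g\<close> times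
    \<open>\<alpha> g h\<close>; since \<alpha> can be cancelled, it is non-zero along with
    \<open>x g\<close>.\<close>
  obtain \<beta> where \<beta>: "\<beta> \<in> carrier (\<B> g)"
      "\<And>b. b \<in> carrier (\<B> g) \<Longrightarrow> \<beta> \<otimes>\<^bsub>\<B> g\<^esub> (b \<otimes>\<^bsub>\<B> g\<^esub> \<alpha> g h) = b"
    using \<alpha>_cancel[OF g(1) h(1) h(3)[symmetric]] by blast
  have ye0: "y e \<noteq> \<zero>\<^bsub>B e\<^esub>"
  proof
    assume "y e = \<zero>\<^bsub>B e\<^esub>"
    hence "\<beta> \<otimes>\<^bsub>\<B> g\<^esub> \<zero>\<^bsub>\<B> g\<^esub> = x g" using \<beta>(2)[OF A_comp[OF xA g(1)]] ye by (simp add: e_def)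
    thus False using g(2) R.r_null[OF \<beta>(1)] by simp
  qed
  define z where "z = \<u> \<one>\<^bsub>B e\<^esub> e \<otimes>\<^bsub>\<A>\<^esub> y"
  have u: "\<u> \<one>\<^bsub>B e\<^esub> e \<in> carrier \<A>" using homog_closed[of _ e] one cdm_id[OF e(1)] by simp
  have zI: "z \<in> I" unfolding z_def by (rule I.I_l_closed[OF yI u])
  have sz: "supp G B z \<subseteq> {k \<in> supp G B y. cdm G k = e}"
    unfolding z_def by (rule supp_homog_ob_mult[OF e(1) one yA])
  have "z e = y e"
    using homog_ob_mult_comp[OF e(1) one yA e(2) cdm_id[OF e(1)]] A_comp[OF yA e(2)] cdm_id[OF e(1)]
    by (simp add: z_def e_def R.l_one)
  hence "z e \<noteq> \<zero>\<^bsub>B e\<^esub>" using ye0 by simp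
  moreover have "supp G B z \<subseteq> isotropy e"
    using sz y_dmn supp_mor by (force simp: isotropy_def)
  moreover have "card (supp G B z) \<le> card (supp G B x)"
    using card_mono[OF A_finite_supp[OF yA], of "supp G B z"] sz card_y by fastforce
  ultimately show ?thesis
    using that[OF e(1) zI] min by (meson le_trans)
qed

text \<open>The difference of \<open>v\<close> and \<open>w\<close> is supported in \<open>T\<close>
  without \<open>g\<close>, hence on fewer than \<open>n\<close> morphisms, and minimality forces it
  to vanish. It is applied to the two products of an element of \<open>I\<close> with a homogeneous
  element, to show that they commute.\<close>

lemma minimal_support_eq:
  assumes I: "nonassoc_ideal I \<A>"
    and min: "\<forall>z\<in>I. z \<noteq> \<zero>\<^bsub>\<A>\<^esub> \<longrightarrow> n \<le> card (supp G B z)"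
    and vw: "v \<in> I" "w \<in> I" and T: "finite T" "card T \<le> n" "supp G B v \<subseteq> T" "supp G B w \<subseteq> T"
    and g: "g \<in> T" "g \<in> mor G" "v g = w g"
  shows "v = w"
proof -
  interpret I: nonassoc_ideal I \<A> by fact
  have vwA: "v \<in> carrier \<A>" "w \<in> carrier \<A>" using vw I.a_subset by auto
  let ?z = "v \<oplus>\<^bsub>\<A>\<^esub> \<ominus>\<^bsub>\<A>\<^esub> w"
  have z: "?z \<in> I" using vw I.a_closed I.uminus_closed by blast
  have c: "?z h = v h \<oplus>\<^bsub>\<B> h\<^esub> \<ominus>\<^bsub>\<B> h\<^esub> w h" if "h \<in> mor G" for h
    using that vwA by simp
  have "supp G B ?z \<subseteq> T - {g}"
  proof
    fix h assume h: "h \<in> supp G B ?z"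
    hence hm: "h \<in> mor G" by (simp add: supp_def)
    interpret H: unital_nonassoc_ring "\<B> h" using B_at hm .
    have "v h \<noteq> w h"
      using h c[OF hm] A_comp[OF vwA(2) hm] by (auto simp: supp_def H.r_neg)
    moreover have "h \<in> supp G B v \<union> supp G B w"
      using calculation hm by (cases "v h = \<zero>\<^bsub>\<B> h\<^esub>") (auto simp: supp_def)
    ultimately show "h \<in> T - {g}" using g T(3,4) by auto
  qed
  hence "card (supp G B ?z) < card T"
    using g(1) T(1) by (meson card_Diff1_less card_mono finite_Diff order.strict_trans1)
  hence "?z = \<zero>\<^bsub>\<A>\<^esub>" using min z T(2) by fastforce
  thus "v = w" using vwA A.minus_equality[of v "\<ominus>\<^bsub>\<A>\<^esub> w"] by (simp add: A.minus_minus)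
qed

section \<open>Part (a): \<open>B\<close> is maximal commutative\<close>

lemma simple_if_maximal_commutative:
  assumes simple: "G_simple G B \<sigma>"
    and max: "maximal_commutative (homogeneous_part G B \<sigma> \<alpha> (ob G)) \<A>"
  shows "simple_nonassoc_ring \<A>"
proof (intro simple_nonassoc_ring.intro simple_nonassoc_ring_axioms.intro A_ring)
  fix I assume I: "nonassoc_ideal I \<A>"
  interpret I: nonassoc_ideal I \<A> by fact
  let ?B = "homogeneous_part G B \<sigma> \<alpha> (ob G)"
  have C: "centralizer \<A> ?B = ?B" using max by (simp add: maximal_commutative_def)
  have uB: "\<u> b e \<in> ?B" "\<u> b e \<in> carrier \<A>" if "e \<in> ob G" "b \<in> carrier (B e)" for b e
    using that homog_closed[of b e] cdm_id[of e] supp_homog[of e b] by (auto simp: homogeneous_part_def)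
  \<comment> \<open>Being its own centralizer, \<open>B\<close> is commutative; comparing
    coefficients at \<open>e\<close> passes this on to \<open>B e\<close>.\<close>
  have comm: "a \<otimes>\<^bsub>B e\<^esub> b = b \<otimes>\<^bsub>B e\<^esub> a"
    if "e \<in> ob G" "a \<in> carrier (B e)" "b \<in> carrier (B e)" for a b e
  proof -
    have "\<u> a e \<in> centralizer \<A> ?B" using uB that C by blast
    hence "\<u> a e \<otimes>\<^bsub>\<A>\<^esub> \<u> b e = \<u> b e \<otimes>\<^bsub>\<A>\<^esub> \<u> a e" using uB that by (simp add: centralizer_def)
    hence "\<u> (a \<otimes>\<^bsub>B e\<^esub> b) e e = \<u> (b \<otimes>\<^bsub>B e\<^esub> a) e e" using homog_mult_ob that by simp
    thus ?thesis using homog_comp[of e e] that(1) ob_mor by auto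
  qed
  have "I = carrier \<A>" if "I \<noteq> {\<zero>\<^bsub>\<A>\<^esub>}"
  proof -
    have "\<not> I \<subseteq> {\<zero>\<^bsub>\<A>\<^esub>}" using that I.zero_closed by (auto dest: subset_singletonD)
    then obtain x0 where x0: "x0 \<in> I" "x0 \<noteq> \<zero>\<^bsub>\<A>\<^esub>" by auto
    obtain e x where e: "e \<in> ob G" and x: "x \<in> I" "x e \<noteq> \<zero>\<^bsub>B e\<^esub>" "supp G B x \<subseteq> isotropy e"
      and min: "\<forall>z\<in>I. z \<noteq> \<zero>\<^bsub>\<A>\<^esub> \<longrightarrow> card (supp G B x) \<le> card (supp G B z)"
      by (rule minimal_support[OF I x0])
    have em: "e \<in> mor G" "cdm G e = e" "dmn G e = e" using e ob_mor cdm_id dmn_id by auto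
    have xA: "x \<in> carrier \<A>" using x I.a_subset by blast
    have xe: "x e \<in> carrier (B e)" using A_comp[OF xA em(1)] em(2) by simp
    have "x \<otimes>\<^bsub>\<A>\<^esub> s = s \<otimes>\<^bsub>\<A>\<^esub> x" if "s \<in> ?B" for s
      using that
    proof (induction rule: homogeneous_part_induct)
      case zero
      show ?case using xA by (simp add: A.l_null A.r_null)
    next
      case (add s t)
      thus ?case using xA by (simp add: A.l_distr A.r_distr)
    next
      case (homog b f)
      have b: "b \<in> carrier (B f)" using homog cdm_id by simp
      note l = supp_homog_ob_mult[OF homog(1) b xA] and r = supp_mult_homog_ob[OF homog(1) b xA]
      have u: "\<u> b f \<in> carrier \<A>" using uB homog(1) b by blast
      show ?case
      proof (cases "f = e")
        case True
        \<comment> \<open>Both products are supported in the support of \<open>x\<close>, which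
          contains \<open>e\<close>, so agreement at \<open>e\<close> alone makes them
          equal.\<close>
        have "(x \<otimes>\<^bsub>\<A>\<^esub> \<u> b f) e = (\<u> b f \<otimes>\<^bsub>\<A>\<^esub> x) e"
          using homog_ob_mult_comp[OF e _ xA em(1,2)] mult_homog_ob_comp[OF e _ xA em(1,3)]
            b True em \<sigma>_id[OF e] comm[OF e xe] by simp
        thus ?thesis
          using minimal_support_eq[OF I min I.I_r_closed[OF x(1) u] I.I_l_closed[OF x(1) u]
              A_finite_supp[OF xA] order_refl _ _ _ em(1)] l r x(2) em by (auto simp: supp_def)
      next
        case False
        \<comment> \<open>Every morphism in the support of \<open>x\<close> starts and ends at
          \<open>e\<close>, so a factor at another object kills \<open>x\<close> from both
          sides.\<close>
        have "supp G B (\<u> b f \<otimes>\<^bsub>\<A>\<^esub> x) = {}" "supp G B (x \<otimes>\<^bsub>\<A>\<^esub> \<u> b f) = {}"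
          using l r x(3) False by (auto simp: isotropy_def)
        thus ?thesis
          using A_eq_zero_iff A_mult_closed xA u by metis
      qed
    qed
    \<comment> \<open>Now the support of \<open>x\<close> consists of objects, and the only object
      in \<open>isotropy e\<close> is \<open>e\<close>.\<close>
    hence "x \<in> ?B" using C xA by (auto simp: centralizer_def)
    hence s: "supp G B x \<subseteq> {e}"
      using x(3) dmn_id by (fastforce simp: homogeneous_part_def isotropy_def)
    have "x = \<u> (x e) e"
    proof (rule A_eqI[OF xA])
      show "\<u> (x e) e \<in> carrier \<A>" using uB e xe by blast
      show "x g = \<u> (x e) e g" if "g \<in> mor G" for g
        using that s by (auto simp: homog_comp supp_def)
    qed
    hence "\<u> (x e) e \<in> I" using x(1) by simp
    thus ?thesis using ideal_eq_carrier[OF I simple e xe x(2)] by blast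
  qed
  thus "I = {\<zero>\<^bsub>\<A>\<^esub>} \<or> I = carrier \<A>" by blast
qed

section \<open>Part (b): simple centers over the isotropy groups\<close>

text \<open>Supports are only required to lie in \<open>S\<close>, not to equal it; this provides
  zero and closure under addition.\<close>

definition coefficients where
  "coefficients I S e = {y e | y. y \<in> I \<and> supp G B y \<subseteq> S}"

text \<open>Multiplying by \<open>\<u> b e\<close> on either side keeps the support inside
  \<open>S\<close> and multiplies the coefficient at \<open>e\<close> by \<open>b\<close>, with no
  twist since \<open>\<sigma> e\<close> is the identity.\<close>

lemma coefficients_ideal:
  assumes I: "nonassoc_ideal I \<A>" and e: "e \<in> ob G" and S: "S \<subseteq> isotropy e"
  shows "nonassoc_ideal (coefficients I S e) (B e)"
proof -
  interpret I: nonassoc_ideal I \<A> by fact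
  interpret R: unital_nonassoc_ring "B e" using B_ring e .
  have em: "e \<in> mor G" "cdm G e = e" "dmn G e = e" using e ob_mor cdm_id dmn_id by auto
  have IA: "y \<in> carrier \<A>" if "y \<in> I" for y using that I.a_subset by blast
  have coeffI: "y e \<in> coefficients I S e" if "y \<in> I" "supp G B y \<subseteq> S" for y
    using that by (auto simp: coefficients_def)
  have off: "y h = \<zero>\<^bsub>\<B> h\<^esub>" if "supp G B y \<subseteq> S" "h \<in> mor G" "h \<notin> S" for y h
    using that by (auto simp: supp_def)
  have supp: "supp G B y \<subseteq> S" if "\<And>h. \<lbrakk>h \<in> mor G; h \<notin> S\<rbrakk> \<Longrightarrow> y h = \<zero>\<^bsub>\<B> h\<^esub>" for y
    using that by (auto simp: supp_def)
  show ?thesis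
  proof (intro nonassoc_ideal.intro nonassoc_ideal_axioms.intro additive_subgroupI[OF B_group[OF e]])
    show "coefficients I S e \<subseteq> carrier (B e)"
      using A_comp[OF IA em(1)] em(2) by (auto simp: coefficients_def)
    have "\<zero>\<^bsub>\<A>\<^esub> e \<in> coefficients I S e"
      by (rule coeffI[OF I.zero_closed]) (auto simp: supp_def)
    thus "\<zero>\<^bsub>B e\<^esub> \<in> coefficients I S e" using em by simp
  next
    fix a b assume "a \<in> coefficients I S e" "b \<in> coefficients I S e"
    then obtain y z where y: "y \<in> I" "supp G B y \<subseteq> S" "a = y e" and z: "z \<in> I" "supp G B z \<subseteq> S" "b = z e"
      by (auto simp: coefficients_def)
    have "supp G B (y \<oplus>\<^bsub>\<A>\<^esub> z) \<subseteq> S"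
    proof (rule supp)
      fix h assume h: "h \<in> mor G" "h \<notin> S"
      interpret H: unital_nonassoc_ring "\<B> h" using B_at h(1) .
      show "(y \<oplus>\<^bsub>\<A>\<^esub> z) h = \<zero>\<^bsub>\<B> h\<^esub>" using off[OF y(2) h] off[OF z(2) h] h by simp
    qed
    hence "(y \<oplus>\<^bsub>\<A>\<^esub> z) e \<in> coefficients I S e" using coeffI I.a_closed y z by blast
    thus "a \<oplus>\<^bsub>B e\<^esub> b \<in> coefficients I S e" using y z em by simp
  next
    fix a assume "a \<in> coefficients I S e"
    then obtain y where y: "y \<in> I" "supp G B y \<subseteq> S" "a = y e"
      by (auto simp: coefficients_def)
    have "supp G B (\<ominus>\<^bsub>\<A>\<^esub> y) \<subseteq> S"
    proof (rule supp)
      fix h assume h: "h \<in> mor G" "h \<notin> S"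
      interpret H: unital_nonassoc_ring "\<B> h" using B_at h(1) .
      show "(\<ominus>\<^bsub>\<A>\<^esub> y) h = \<zero>\<^bsub>\<B> h\<^esub>" using off[OF y(2) h] h IA[OF y(1)] by simp
    qed
    hence "(\<ominus>\<^bsub>\<A>\<^esub> y) e \<in> coefficients I S e" using coeffI I.uminus_closed y by blast
    thus "\<ominus>\<^bsub>B e\<^esub> a \<in> coefficients I S e" using y em IA by simp
  next
    fix a b assume "a \<in> coefficients I S e" and b: "b \<in> carrier (B e)"
    then obtain y where y: "y \<in> I" "supp G B y \<subseteq> S" "a = y e"
      by (auto simp: coefficients_def)
    have u: "\<u> b e \<in> carrier \<A>" using homog_closed[of b e] b em by simp
    have "(\<u> b e \<otimes>\<^bsub>\<A>\<^esub> y) e \<in> coefficients I S e"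
      using coeffI[OF I.I_l_closed[OF y(1) u]] supp_homog_ob_mult[OF e b IA[OF y(1)]] y(2) by blast
    thus "b \<otimes>\<^bsub>B e\<^esub> a \<in> coefficients I S e"
      using homog_ob_mult_comp[OF e b IA[OF y(1)] em(1,2)] y(3) by simp
    have "(y \<otimes>\<^bsub>\<A>\<^esub> \<u> b e) e \<in> coefficients I S e"
      using coeffI[OF I.I_r_closed[OF y(1) u]] supp_mult_homog_ob[OF e b IA[OF y(1)]] y(2) by blast
    thus "a \<otimes>\<^bsub>B e\<^esub> b \<in> coefficients I S e"
      using mult_homog_ob_comp[OF e b IA[OF y(1)] em(1,3)] y(3) em \<sigma>_id[OF e b] by simp
  qed
qed

text \<open>Conjugation by elements of the abelian group \<open>G\<^sub>e\<close> preserves \<open>S\<close>.\<close>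

lemma coefficients_invariant:
  assumes I: "nonassoc_ideal I \<A>" and e: "e \<in> ob G" and S: "S \<subseteq> isotropy e"
    and comm: "\<And>g h. \<lbrakk>g \<in> isotropy e; h \<in> isotropy e\<rbrakk> \<Longrightarrow> cmp G g h = cmp G h g"
    and g: "g \<in> isotropy e" and b: "b \<in> coefficients I S e"
  shows "\<sigma> g b \<in> coefficients I S e"
proof -
  interpret I: nonassoc_ideal I \<A> by fact
  interpret R: unital_nonassoc_ring "B e" using B_ring e .
  have em: "e \<in> mor G" "cdm G e = e" "dmn G e = e" using e ob_mor cdm_id dmn_id by auto
  obtain y where y: "y \<in> I" "supp G B y \<subseteq> S" "b = y e"
    using b by (auto simp: coefficients_def)
  have IA: "y \<in> carrier \<A>" if "y \<in> I" for y using that I.a_subset by blast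
  have gm: "g \<in> mor G" "dmn G g = e" "cdm G g = e" using g by (auto simp: isotropy_def)
  obtain h where h: "h \<in> mor G" "dmn G h = e" "cdm G h = e" "cmp G g h = e" "cmp G h g = e"
    using inverseE[OF gm(1)] gm by metis
  have hi: "h \<in> isotropy e" using h by (simp add: isotropy_def)
  have bc: "b \<in> carrier (B e)" using A_comp[OF IA[OF y(1)] em(1)] em y by simp
  have \<sigma>b: "\<sigma> g b \<in> carrier (B e)" using \<sigma>_closed[OF gm(1)] gm bc by simp
  have \<alpha>: "\<alpha> g h \<in> carrier (B e)" using \<alpha>_closed[OF gm(1) h(1)] gm h by simp
  have \<sigma>1: "\<sigma> g \<one>\<^bsub>B e\<^esub> = \<one>\<^bsub>B e\<^esub>" using ring_hom_one[OF \<sigma>_hom[OF gm(1)]] gm by simp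
  obtain \<beta> where \<beta>: "\<beta> \<in> carrier (\<B> g)"
      "\<And>b. b \<in> carrier (\<B> g) \<Longrightarrow> \<beta> \<otimes>\<^bsub>\<B> g\<^esub> (b \<otimes>\<^bsub>\<B> g\<^esub> \<alpha> g h) = b"
    using \<alpha>_cancel[OF gm(1) h(1)] gm h by metis
  have \<beta>': "\<beta> \<in> carrier (B e)" "\<beta> \<otimes>\<^bsub>B e\<^esub> (\<sigma> g b \<otimes>\<^bsub>B e\<^esub> \<alpha> g h) = \<sigma> g b"
    using \<beta> gm \<sigma>b by simp_all
  have one: "\<one>\<^bsub>B e\<^esub> \<in> carrier (\<B> g)" "\<one>\<^bsub>B e\<^esub> \<in> carrier (\<B> h)" using R.one_closed gm h by simp_all
  \<comment> \<open>Conjugation of \<open>y\<close>: the coefficient \<open>b\<close> at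
    \<open>e\<close> becomes \<open>\<sigma> g b\<close> at \<open>g\<close> in \<open>v\<close>,
    and \<open>\<sigma> g b\<close> times \<open>\<alpha> g h\<close> at \<open>e\<close> in
    \<open>w\<close>.\<close>
  define v where "v = \<u> \<one>\<^bsub>B e\<^esub> g \<otimes>\<^bsub>\<A>\<^esub> y"
  define w where "w = v \<otimes>\<^bsub>\<A>\<^esub> \<u> \<one>\<^bsub>B e\<^esub> h"
  have vI: "v \<in> I" unfolding v_def by (rule I.I_l_closed[OF y(1) homog_closed[OF one(1)]])
  have wI: "w \<in> I" unfolding w_def by (rule I.I_r_closed[OF vI homog_closed[OF one(2)]])
  have vg: "v g = \<sigma> g b"
    using homog_mult_comp[OF gm(1) em(1) _ one(1) IA[OF y(1)]] gm em cmp_id_right[OF gm(1)]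
      \<alpha>_id_right[OF gm(1)] y(3) \<sigma>b
    by (simp add: v_def R.l_one R.r_one)
  have we: "w e = \<sigma> g b \<otimes>\<^bsub>B e\<^esub> \<alpha> g h"
    using mult_homog_comp[OF h(1) gm(1) _ one(2) IA[OF vI]] gm h vg \<sigma>1 \<sigma>b
    by (simp add: w_def R.r_one)
  have "supp G B w \<subseteq> S"
  proof
    fix k assume "k \<in> supp G B w"
    then obtain l where l: "l \<in> supp G B v" "k = cmp G l h"
      using supp_mult_homog[OF h(1) one(2) IA[OF vI]] by (auto simp: w_def)
    then obtain m where m: "m \<in> S" "l = cmp G g m"
      using supp_homog_mult[OF gm(1) one(1) IA[OF y(1)]] y(2) by (auto simp: v_def)
    have mi: "m \<in> isotropy e" "m \<in> mor G" "dmn G m = e" using m S by (auto simp: isotropy_def)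
    have "k = cmp G (cmp G m g) h" using l m comm[OF g mi(1)] by simp
    also have "\<dots> = m"
      using cmp_assoc[OF mi(2) gm(1) h(1)] gm mi h cmp_id_right[OF mi(2)] by simp
    finally show "k \<in> S" using m by simp
  qed
  hence "w e \<in> coefficients I S e" using wI by (auto simp: coefficients_def)
  \<comment> \<open>The factor \<open>\<alpha> g h\<close> is removed inside the ideal by left
    multiplication with \<beta>.\<close>
  hence "\<beta> \<otimes>\<^bsub>B e\<^esub> w e \<in> coefficients I S e"
    using nonassoc_ideal.I_l_closed[OF coefficients_ideal[OF I e S]] \<beta>'(1) by blast
  thus ?thesis using we \<beta>'(2) by simp
qed

text \<open>The ideal lives at \<open>e\<close> only, and \<open>K\<close> spreads it over all
  objects. Each \<open>K f\<close> is an intersection of preimages under ring homomorphisms, hence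
  an ideal; where no morphism leads from \<open>f\<close> to \<open>e\<close> it is all of
  \<open>B f\<close>. Invariance of the family is functoriality of \<sigma>.\<close>

lemma coefficients_eq_carrier:
  assumes I: "nonassoc_ideal I \<A>" and simple: "G_simple G B \<sigma>"
    and e: "e \<in> ob G" and S: "S \<subseteq> isotropy e"
    and comm: "\<And>g h. \<lbrakk>g \<in> isotropy e; h \<in> isotropy e\<rbrakk> \<Longrightarrow> cmp G g h = cmp G h g"
    and b: "b \<in> coefficients I S e" "b \<noteq> \<zero>\<^bsub>B e\<^esub>"
  shows "coefficients I S e = carrier (B e)"
proof -
  let ?J = "coefficients I S e"
  have em: "e \<in> mor G" "cdm G e = e" "dmn G e = e" using e ob_mor cdm_id dmn_id by auto
  have J: "nonassoc_ideal ?J (B e)" by (rule coefficients_ideal[OF I e S])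
  interpret J: nonassoc_ideal ?J "B e" by (rule J)
  define K where "K f = {b \<in> carrier (B f). \<forall>g\<in>mor G. dmn G g = f \<and> cdm G g = e \<longrightarrow> \<sigma> g b \<in> ?J}" for f
  have K: "nonassoc_ideal (K f) (B f)" if f: "f \<in> ob G" for f
  proof -
    interpret F: unital_nonassoc_ring "B f" using B_ring f .
    have hom: "\<sigma> g \<in> ring_hom (B f) (B e)" if "g \<in> mor G" "dmn G g = f" "cdm G g = e" for g
      using \<sigma>_hom[OF that(1)] that by simp
    note [simp] = ring_hom_add[OF hom] ring_hom_mult[OF hom] ring_hom_closed[OF hom]
      ring_hom_zero_group[OF hom B_group[OF f] B_group[OF e]]
      ring_hom_uminus_group[OF hom B_group[OF f] B_group[OF e]]
    show ?thesis
      by (intro nonassoc_ideal.intro nonassoc_ideal_axioms.intro additive_subgroupI[OF B_group[OF f]])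
        (auto simp: K_def F.m_closed J.a_closed J.uminus_closed J.zero_closed J.I_l_closed J.I_r_closed)
  qed
  have inv: "\<sigma> g c \<in> K (cdm G g)" if g: "g \<in> mor G" and c: "c \<in> K (dmn G g)" for g c
  proof -
    have c': "c \<in> carrier (B (dmn G g))" using c by (simp add: K_def)
    have "\<sigma> h (\<sigma> g c) \<in> ?J" if h: "h \<in> mor G" "dmn G h = cdm G g" "cdm G h = e" for h
      using \<sigma>_cmp[OF h(1) g h(2) c'] c cmp_mor[OF h(1) g h(2)] dmn_cmp[OF h(1) g h(2)]
        cdm_cmp[OF h(1) g h(2)] h(3)
      by (auto simp: K_def)
    thus ?thesis using \<sigma>_closed[OF g c'] by (simp add: K_def)
  qed
  \<comment> \<open>The morphisms from \<open>e\<close> to \<open>e\<close> form the isotropy group,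
    under which the coefficients are stable; so \<open>K\<close> is non-zero at
    \<open>e\<close>.\<close>
  have bK: "b \<in> K e"
    using coefficients_invariant[OF I e S comm _ b(1)] J.a_subset b(1) by (auto simp: K_def isotropy_def)
  have full: "K e = carrier (B e)"
    by (rule G_simple_ideal_family[OF simple K inv e bK b(2) e])
  have "c \<in> ?J" if c: "c \<in> carrier (B e)" for c
  proof -
    \<comment> \<open>The identity \<open>e\<close> is among the morphisms tested in
      \<open>K e\<close>, which gives the inclusion of \<open>K e\<close> in
      \<open>?J\<close>.\<close>
    have "\<sigma> e c \<in> ?J" using c full em by (auto simp: K_def)
    thus ?thesis using \<sigma>_id[OF e c] by simp
  qed
  thus ?thesis using J.a_subset by blast
qed

lemma simple_if_center_simple:
  assumes simple: "G_simple G B \<sigma>" and abelian: "locally_abelian G"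
    and center: "\<And>e. e \<in> ob G \<Longrightarrow> simple_nonassoc_ring (center (restrict_ring \<A>
      (homogeneous_part G B \<sigma> \<alpha> (carrier (vertex_group G e)))))"
  shows "simple_nonassoc_ring \<A>"
proof (intro simple_nonassoc_ring.intro simple_nonassoc_ring_axioms.intro A_ring)
  fix I assume I: "nonassoc_ideal I \<A>"
  interpret I: nonassoc_ideal I \<A> by fact
  have "I = carrier \<A>" if "I \<noteq> {\<zero>\<^bsub>\<A>\<^esub>}"
  proof -
    have "\<not> I \<subseteq> {\<zero>\<^bsub>\<A>\<^esub>}" using that I.zero_closed by (auto dest: subset_singletonD)
    then obtain x0 where x0: "x0 \<in> I" "x0 \<noteq> \<zero>\<^bsub>\<A>\<^esub>" by auto
    obtain e x where e: "e \<in> ob G" and x: "x \<in> I" "x e \<noteq> \<zero>\<^bsub>B e\<^esub>" "supp G B x \<subseteq> isotropy e"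
      and min: "\<forall>z\<in>I. z \<noteq> \<zero>\<^bsub>\<A>\<^esub> \<longrightarrow> card (supp G B x) \<le> card (supp G B z)"
      by (rule minimal_support[OF I x0])
    interpret R: unital_nonassoc_ring "B e" using B_ring e .
    let ?S = "supp G B x"
    have em: "e \<in> mor G" "cdm G e = e" "dmn G e = e" using e ob_mor cdm_id dmn_id by auto
    have S: "finite ?S" using A_finite_supp x(1) I.a_subset by blast
    have vertex: "carrier (vertex_group G e) = isotropy e"
      by (simp add: vertex_group_def isotropy_def)
    have comm: "cmp G g h = cmp G h g" if "g \<in> isotropy e" "h \<in> isotropy e" for g h
    proof -
      interpret V: comm_group "vertex_group G e" using abelian e by (simp add: locally_abelian_def)
      show ?thesis using V.m_comm[of g h] that by (simp add: vertex_group_def isotropy_def)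
    qed
    have "x e \<in> coefficients I ?S e" using x(1) by (auto simp: coefficients_def)
    hence "coefficients I ?S e = carrier (B e)"
      using coefficients_eq_carrier[OF I simple e x(3) comm] x(2) by blast
    hence "\<one>\<^bsub>B e\<^esub> \<in> coefficients I ?S e" using R.one_closed by simp
    then obtain y where y: "y \<in> I" "supp G B y \<subseteq> ?S" "y e = \<one>\<^bsub>B e\<^esub>"
      by (auto simp: coefficients_def)
    have yA: "y \<in> carrier \<A>" using y I.a_subset by blast
    let ?H = "homogeneous_part G B \<sigma> \<alpha> (isotropy e)"
    let ?Z = "center (restrict_ring \<A> ?H)"
    have central: "y \<otimes>\<^bsub>\<A>\<^esub> s = s \<otimes>\<^bsub>\<A>\<^esub> y" if "s \<in> ?H" for s
      using that
    proof (induction rule: homogeneous_part_induct)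
      case zero
      show ?case using yA by (simp add: A.l_null A.r_null)
    next
      case (add s t)
      thus ?case using yA by (simp add: A.l_distr A.r_distr)
    next
      case (homog b g)
      have g: "dmn G g = e" "cdm G g = e" and b: "b \<in> carrier (B e)"
        using homog by (auto simp: isotropy_def)
      have u: "\<u> b g \<in> carrier \<A>" by (rule homog_closed[OF homog(3)])
      show ?case
      \<comment> \<open>The common support set is the translate of \<open>?S\<close> by
        \<open>g\<close>: left and right translates agree because the isotropy group is abelian. At
        \<open>g\<close> both coefficients are \<open>b\<close>, because \<open>y e\<close> is 1 and
        \<open>\<sigma> g\<close> preserves 1.\<close>
      proof (rule minimal_support_eq[OF I min I.I_r_closed[OF y(1) u] I.I_l_closed[OF y(1) u]])
        show "finite (cmp G g ` ?S)" "card (cmp G g ` ?S) \<le> card ?S"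
          using S card_image_le by auto
        show "supp G B (\<u> b g \<otimes>\<^bsub>\<A>\<^esub> y) \<subseteq> cmp G g ` ?S"
          using supp_homog_mult[OF homog(2,3) yA] y(2) by blast
        show "supp G B (y \<otimes>\<^bsub>\<A>\<^esub> \<u> b g) \<subseteq> cmp G g ` ?S"
        proof
          fix k assume "k \<in> supp G B (y \<otimes>\<^bsub>\<A>\<^esub> \<u> b g)"
          then obtain h where h: "h \<in> ?S" "k = cmp G h g"
            using supp_mult_homog[OF homog(2,3) yA] y(2) by blast
          hence "k = cmp G g h" using comm[OF homog(1), of h] x(3) by auto
          thus "k \<in> cmp G g ` ?S" using h(1) by blast
        qed
        have "e \<in> ?S" using x(2) em by (simp add: supp_def)
        thus "g \<in> cmp G g ` ?S" using cmp_id_right[OF homog(2)] g by force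
        show "(y \<otimes>\<^bsub>\<A>\<^esub> \<u> b g) g = (\<u> b g \<otimes>\<^bsub>\<A>\<^esub> y) g"
          using homog_mult_comp[OF homog(2) em(1) _ homog(3) yA]
            mult_homog_comp[OF homog(2) em(1) _ homog(3) yA]
            g em cmp_id_right[OF homog(2)] cmp_id_left[OF homog(2)] y(3)
            \<alpha>_id_left[OF homog(2)] \<alpha>_id_right[OF homog(2)] b \<sigma>_id[OF e b]
            ring_hom_one[OF \<sigma>_hom[OF homog(2)]]
          by (simp add: R.l_one R.r_one)
      qed (use homog in auto)
    qed
    interpret Z: simple_nonassoc_ring ?Z using center[OF e] vertex by simp
    have Z: "z \<in> carrier ?Z \<longleftrightarrow> z \<in> ?H \<and> (\<forall>s\<in>?H. z \<otimes>\<^bsub>\<A>\<^esub> s = s \<otimes>\<^bsub>\<A>\<^esub> z)" for z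
      by (simp add: center_def centralizer_def)
    have "?H \<subseteq> carrier \<A>" by (auto simp: homogeneous_part_def)
    hence ZA: "z \<in> carrier \<A>" if "z \<in> carrier ?Z" for z
      using that Z by blast
    have ops: "\<zero>\<^bsub>?Z\<^esub> = \<zero>\<^bsub>\<A>\<^esub>" "z \<oplus>\<^bsub>?Z\<^esub> z' = z \<oplus>\<^bsub>\<A>\<^esub> z'" "z \<otimes>\<^bsub>?Z\<^esub> z' = z \<otimes>\<^bsub>\<A>\<^esub> z'" for z z'
      by (simp_all add: center_def)
    \<comment> \<open>Negatives in \<open>?Z\<close> are taken relative to the smaller carrier;
      uniqueness of additive inverses in \<open>\<A>\<close> shows that they are the same.\<close>
    have neg: "\<ominus>\<^bsub>?Z\<^esub> z = \<ominus>\<^bsub>\<A>\<^esub> z" if z: "z \<in> carrier ?Z" for z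
      using A.minus_equality[OF _ ZA[OF z] ZA[OF Z.a_inv_closed[OF z]]] Z.l_neg[OF z] by (simp add: ops)
    have "additive_subgroup (I \<inter> carrier ?Z) ?Z"
    proof (rule additive_subgroupI[OF Z.abelian_group_axioms])
      show "\<zero>\<^bsub>?Z\<^esub> \<in> I \<inter> carrier ?Z" using I.zero_closed Z.zero_closed by (simp add: ops)
      show "z \<oplus>\<^bsub>?Z\<^esub> z' \<in> I \<inter> carrier ?Z" if "z \<in> I \<inter> carrier ?Z" "z' \<in> I \<inter> carrier ?Z" for z z'
        using that I.a_closed Z.a_closed[of z z'] by (simp add: ops)
      show "\<ominus>\<^bsub>?Z\<^esub> z \<in> I \<inter> carrier ?Z" if "z \<in> I \<inter> carrier ?Z" for z
        using that I.uminus_closed neg Z.a_inv_closed by fastforce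
    qed auto
    moreover have "z \<otimes>\<^bsub>?Z\<^esub> a \<in> I \<inter> carrier ?Z \<and> a \<otimes>\<^bsub>?Z\<^esub> z \<in> I \<inter> carrier ?Z"
      if "a \<in> I \<inter> carrier ?Z" "z \<in> carrier ?Z" for a z
      using that I.I_l_closed I.I_r_closed ZA Z.m_closed[of z a] Z.m_closed[of a z] by (simp add: ops)
    ultimately have "nonassoc_ideal (I \<inter> carrier ?Z) ?Z"
      by (intro nonassoc_ideal.intro nonassoc_ideal_axioms.intro) auto
    moreover have "y \<in> ?H"
      using y(2) x(3) yA by (auto simp: homogeneous_part_def)
    hence "y \<in> carrier ?Z" using central Z by blast
    moreover have "y \<noteq> \<zero>\<^bsub>\<A>\<^esub>"
      using y(3) R.one_not_zero em by auto
    \<comment> \<open>The ideal \<open>I \<inter> carrier ?Z\<close> contains the non-zero element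
      \<open>y\<close>, so simplicity of the center makes it everything.\<close>
    ultimately have IZ: "I \<inter> carrier ?Z = carrier ?Z"
      using Z.trivial_ideals y(1) by (auto simp: ops)
    have u: "\<u> \<one>\<^bsub>B e\<^esub> e \<in> carrier \<A>" using homog_closed[of _ e] R.one_closed em by simp
    \<comment> \<open>This element is a two-sided identity on \<open>?H\<close>, hence central, and
      so it lies in \<open>I\<close>.\<close>
    have "\<u> \<one>\<^bsub>B e\<^esub> e \<in> carrier ?Z"
      unfolding Z
    proof (intro conjI ballI)
      show "\<u> \<one>\<^bsub>B e\<^esub> e \<in> ?H"
        using u supp_homog[of e] ob_isotropy[OF e] by (auto simp: homogeneous_part_def)
      fix s assume s: "s \<in> ?H"
      hence sA: "s \<in> carrier \<A>" and ss: "supp G B s \<subseteq> isotropy e" by (auto simp: homogeneous_part_def)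
      show "\<u> \<one>\<^bsub>B e\<^esub> e \<otimes>\<^bsub>\<A>\<^esub> s = s \<otimes>\<^bsub>\<A>\<^esub> \<u> \<one>\<^bsub>B e\<^esub> e"
      proof (rule A_eqI)
        fix h assume h: "h \<in> mor G"
        show "(\<u> \<one>\<^bsub>B e\<^esub> e \<otimes>\<^bsub>\<A>\<^esub> s) h = (s \<otimes>\<^bsub>\<A>\<^esub> \<u> \<one>\<^bsub>B e\<^esub> e) h"
        proof (cases "h \<in> isotropy e")
          case True
          hence hi: "dmn G h = e" "cdm G h = e" by (auto simp: isotropy_def)
          have "s h \<in> carrier (B e)" using A_comp[OF sA h] hi by simp
          thus ?thesis
            using homog_ob_mult_comp[OF e R.one_closed sA h hi(2)]
              mult_homog_ob_comp[OF e R.one_closed sA h hi(1)] ring_hom_one[OF \<sigma>_hom[OF h]] hi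
            by (simp add: R.l_one R.r_one)
        next
          case False
          hence "h \<notin> supp G B (\<u> \<one>\<^bsub>B e\<^esub> e \<otimes>\<^bsub>\<A>\<^esub> s)" "h \<notin> supp G B (s \<otimes>\<^bsub>\<A>\<^esub> \<u> \<one>\<^bsub>B e\<^esub> e)"
            using supp_homog_ob_mult[OF e R.one_closed sA] supp_mult_homog_ob[OF e R.one_closed sA] ss
            by auto
          thus ?thesis using h by (simp add: supp_def)
        qed
      qed (use A_mult_closed u sA in auto)
    qed
    hence "\<u> \<one>\<^bsub>B e\<^esub> e \<in> I" using IZ by blast
    thus ?thesis using ideal_eq_carrier[OF I simple e R.one_closed R.one_not_zero] by blast
  qed
  thus "I = {\<zero>\<^bsub>\<A>\<^esub>} \<or> I = carrier \<A>" by blast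
qed

end

theorem proposition3p15:
  fixes G :: "'g cat" and B :: "'g \<Rightarrow> 'b ring"
    and \<sigma> :: "'g \<Rightarrow> 'b \<Rightarrow> 'b" and \<alpha> :: "'g \<Rightarrow> 'g \<Rightarrow> 'b"
  defines "A \<equiv> crossed_product G B \<sigma> \<alpha>"
  assumes "groupoid G"
    and "crossed_system G B \<sigma> \<alpha>"
    and "G_simple G B \<sigma>"
  shows "(maximal_commutative (homogeneous_part G B \<sigma> \<alpha> (ob G)) A
            \<longrightarrow> simple_nonassoc_ring A)
       \<and> (locally_abelian G \<and> connected_cat G
            \<and> (\<forall>e\<in>ob G. simple_nonassoc_ring (center (restrict_ring A
                  (homogeneous_part G B \<sigma> \<alpha> (carrier (vertex_group G e))))))
            \<longrightarrow> simple_nonassoc_ring A)"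
proof -
  interpret groupoid_crossed_system G B \<sigma> \<alpha>
    using assms(2,3) by (rule groupoid_crossed_system.intro)
  show ?thesis
    unfolding A_def
    using simple_if_maximal_commutative[OF assms(4)] simple_if_center_simple[OF assms(4)] by blast
qed

end
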